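(* Let $p>1$, $a>0$, and let $u_0\in C([0,a])$ with $u_0>0$ in $[0,a]$. Let $u(t,x)$ be the solution, with maximal existence time $T_{\max}\le +\infty$, of $$ \begin{cases} u_t=u^p(u_{xx}+u-\bar u), & 0<t<T_{\max},\ 0<x<a,\\ u_x(t,0)=u_x(t,a)=0, & 0<t<T_{\max},\\ u(0,x)=u_0(x), & 0<x<a, \end{cases} $$ where $\bar u(t)=\frac1a\int_0^a u(t,x)\,dx$. If $E[u](0)<0$, then $u(t,x)$ blows up in finite time, i.e. $T_{\max}<+\infty$.
   Context: The energy functional is $E[u](t)=\int_0^a\left[u_x^2-(u-\bar u)^2\right]dx$, evaluated at time $t$; in particular $E[u](0)=E[u_0]=\int_0^a[(u_0')^2-(u_0-\bar u_0)^2]\,dx$ (with value $+\infty$ if $u_0\notin H^1((0,a))$, so $E[u](0)<0$ presupposes $u_0\in H^1((0,a))$). A solution means the positive solution $u>0$ on $[0,T_{\max})\times[0,a]$, continuous up to $t=0$ and classical ($C^1$ in $t$, $C^2$ in $x$) for $0<t<T_{\max}$; $T_{\max}$ is its maximal time of existence. Positivity of $u_0$ guarantees positivity of the solution on $0<t<T_{\max}$. *)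

theory Defs
  imports "HOL-Analysis.Analysis"
begin

definition mean :: "real \<Rightarrow> (real \<Rightarrow> real) \<Rightarrow> real" where
  "mean a v = (1 / a) * (LBINT x:{0..a}. v x)"

definition smooth :: "(real \<Rightarrow> real) \<Rightarrow> bool" where
  "smooth \<phi> \<longleftrightarrow>
    (\<exists>D :: nat \<Rightarrow> real \<Rightarrow> real. D 0 = \<phi> \<and> (\<forall>n x. (D n has_real_derivative D (Suc n) x) (at x)))"

(* The space of smooth functions with compact support in (0,a); the support is automatically
   compact, being closed and bounded. *)
definition test_function :: "real \<Rightarrow> (real \<Rightarrow> real) \<Rightarrow> bool" where
  "test_function a \<phi> \<longleftrightarrow> smooth \<phi> \<and> closure {x. \<phi> x \<noteq> 0} \<subseteq> {0<..<a}"

definition square_integrable :: "real \<Rightarrow> (real \<Rightarrow> real) \<Rightarrow> bool" where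
  "square_integrable a f \<longleftrightarrow>
    set_borel_measurable lborel {0<..<a} f \<and> set_integrable lborel {0<..<a} (\<lambda>x. (f x)\<^sup>2)"

definition is_weak_deriv :: "real \<Rightarrow> (real \<Rightarrow> real) \<Rightarrow> (real \<Rightarrow> real) \<Rightarrow> bool" where
  "is_weak_deriv a f g \<longleftrightarrow>
    (\<forall>\<phi>. test_function a \<phi> \<longrightarrow>
      (LBINT x:{0<..<a}. f x * deriv \<phi> x) = - (LBINT x:{0<..<a}. g x * \<phi> x))"

(* The Sobolev space H^1((0,a)). *)
definition H1 :: "real \<Rightarrow> (real \<Rightarrow> real) set" where
  "H1 a = {f. square_integrable a f \<and> (\<exists>g. square_integrable a g \<and> is_weak_deriv a f g)}"

(* A representative of the weak derivative, which is unique up to null sets. *)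
definition weak_deriv :: "real \<Rightarrow> (real \<Rightarrow> real) \<Rightarrow> real \<Rightarrow> real" where
  "weak_deriv a f = (SOME g. square_integrable a g \<and> is_weak_deriv a f g)"

definition energy :: "real \<Rightarrow> (real \<Rightarrow> real) \<Rightarrow> ereal" where
  "energy a v =
    (if v \<in> H1 a
     then ereal (LBINT x:{0..a}. (weak_deriv a v x)\<^sup>2 - (v x - mean a v)\<^sup>2)
     else \<infinity>)"

(* u is positive and continuous on [0,T) x [0,a], and of class C^{1,2} on (0,T) x [0,a]: ut, ux, uxx
   are its partial derivatives (one-sided in x at the end points), jointly continuous there.
   Values of u outside [0,T) x [0,a] are irrelevant. *)
definition classical_solution ::
    "real \<Rightarrow> real \<Rightarrow> (real \<Rightarrow> real) \<Rightarrow> ereal \<Rightarrow> (real \<Rightarrow> real \<Rightarrow> real) \<Rightarrow> bool" where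
  "classical_solution p a u0 T u \<longleftrightarrow>
    0 < T \<and>
    continuous_on ({t. 0 \<le> t \<and> ereal t < T} \<times> {0..a}) (\<lambda>(t, x). u t x) \<and>
    (\<forall>t x. 0 \<le> t \<and> ereal t < T \<and> x \<in> {0..a} \<longrightarrow> 0 < u t x) \<and>
    (\<exists>ut ux uxx.
      continuous_on ({t. 0 < t \<and> ereal t < T} \<times> {0..a}) (\<lambda>(t, x). ut t x) \<and>
      continuous_on ({t. 0 < t \<and> ereal t < T} \<times> {0..a}) (\<lambda>(t, x). ux t x) \<and>
      continuous_on ({t. 0 < t \<and> ereal t < T} \<times> {0..a}) (\<lambda>(t, x). uxx t x) \<and>
      (\<forall>t x. 0 < t \<and> ereal t < T \<and> x \<in> {0..a} \<longrightarrow>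
        ((\<lambda>s. u s x) has_real_derivative ut t x) (at t) \<and>
        (u t has_real_derivative ux t x) (at x within {0..a}) \<and>
        (ux t has_real_derivative uxx t x) (at x within {0..a})) \<and>
      (\<forall>t x. 0 < t \<and> ereal t < T \<and> x \<in> {0<..<a} \<longrightarrow>
        ut t x = u t x powr p * (uxx t x + u t x - mean a (u t))) \<and>
      (\<forall>t. 0 < t \<and> ereal t < T \<longrightarrow> ux t 0 = 0 \<and> ux t a = 0)) \<and>
    (\<forall>x\<in>{0<..<a}. u 0 x = u0 x)"

(* A solution that cannot be continued beyond time T. *)
definition maximal_solution ::
    "real \<Rightarrow> real \<Rightarrow> (real \<Rightarrow> real) \<Rightarrow> ereal \<Rightarrow> (real \<Rightarrow> real \<Rightarrow> real) \<Rightarrow> bool" where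
  "maximal_solution p a u0 T u \<longleftrightarrow>
    classical_solution p a u0 T u \<and>
    \<not> (\<exists>T' v. T < T' \<and> classical_solution p a u0 T' v \<and>
          (\<forall>t x. 0 \<le> t \<and> ereal t < T \<and> x \<in> {0..a} \<longrightarrow> v t x = u t x))"

end

(* Suppose the solution is global and let D = - E[u] and Y = \<integral> u^(2-p). Multiplying the equation
   u^(-p) u_t = w, where w = u_xx + u - mean u, by u and by u_t gives
     Y' = (2 - p) D,   D' = 2 \<integral> u^(-p) u_t^2,
   and Cauchy-Schwarz for D = \<integral> u^(1-p) u_t gives D^2 \<le> Y D' / 2. Hence (Y / D)' \<le> (2 - p) - 2 = - p,
   so the positive quantity Y / D would have to become negative in finite time.

   Positivity of D for t > 0 is inherited from E[u(0)] < 0 although u(0) is only in H^1: since the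
   Dirichlet integral is convex, it suffices to find small times at which
   \<integral> u^(-p) u_t (u - u(0)) \<ge> 0. This integral is the derivative of a functional that is minimal at t = 0. *)

theory Submission
  imports Defs
begin

section \<open>A smooth step function\<close>

text \<open>The obstacle is the initial time. The energy of \<open>u 0\<close> is defined through a
  weak derivative, tested only against smooth functions with compact support. For t > 0 the solution
  is classical, but nothing bounds \<open>ux\<close> or \<open>uxx\<close> as t tends to 0: only
  \<open>u\<close> itself is continuous down to t = 0. The two descriptions meet when the weak
  derivative of \<open>u 0\<close> is integrated by parts against \<open>ux t\<close>, which is
  merely C^1 and vanishes at the ends without having compact support. This is why explicit test
  functions are constructed: they identify a continuous function having a square integrable weak
  derivative with an indefinite integral of that derivative. The quotient Y / D treats all p > 1
  alike, although, while D > 0, Y increases for p < 2, is constant for p = 2 and decreases for p >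
  2.\<close>

definition flat :: "nat \<Rightarrow> real \<Rightarrow> real" where
  "flat n x = (if 0 < x then exp (- (1 / x)) / x ^ n else 0)"

lemma flat_tendsto_0: "(flat n \<longlongrightarrow> 0) (at 0)"
proof (rule filterlim_split_at)
  have "\<forall>\<^sub>F x in at_left 0. flat n x = (0::real)"
    by (auto simp: eventually_at_left_field flat_def intro!: exI[of _ "-1"])
  then show "(flat n \<longlongrightarrow> 0) (at_left 0)" by (rule tendsto_eventually)
  have "((\<lambda>x::real. (inverse x) ^ n / exp (inverse x)) \<longlongrightarrow> 0) (at_right 0)"
    by (rule filterlim_compose[OF tendsto_power_div_exp_0 filterlim_inverse_at_top_right])
  moreover have "\<forall>\<^sub>F x in at_right 0. (inverse x) ^ n / exp (inverse x) = flat n x"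
    by (auto simp: eventually_at_right_field flat_def exp_minus field_simps intro!: exI[of _ "1"])
  ultimately show "(flat n \<longlongrightarrow> 0) (at_right 0)" by (rule Lim_transform_eventually)
qed

text \<open>The factor 1 / x^n keeps derivatives inside the span of the family. At 0 the difference
  quotient of \<open>flat n\<close> is \<open>flat (n + 1)\<close> itself, so the limit at 0 already
  proved gives the derivative there.\<close>

lemma flat_has_real_derivative:
  "(flat n has_real_derivative flat (n + 2) x - real n * flat (n + 1) x) (at x)"
proof -
  consider "x < 0" | "x = 0" | "0 < x" by linarith
  then show ?thesis
  proof cases
    case 1
    have "((\<lambda>_. 0) has_real_derivative 0) (at x)" by simp
    moreover have "\<forall>\<^sub>F y in nhds x. flat n y = 0"
      using eventually_nhds_in_open[of "{..<0}" x] 1 by (auto elim!: eventually_mono simp: flat_def)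
    ultimately have "(flat n has_real_derivative 0) (at x)"
      by (subst DERIV_cong_ev[OF refl _ refl]) auto
    then show ?thesis using 1 by (simp add: flat_def)
  next
    case 2
    have flat_at_0: "flat k 0 = 0" for k by (simp add: flat_def)
    have "flat n h / h = flat (n + 1) h" for h by (auto simp: flat_def)
    then show ?thesis
      using flat_tendsto_0[of "n + 1"] 2 flat_at_0 by (simp add: DERIV_def)
  next
    case 3
    have "((\<lambda>x. exp (- (1 / x)) / x ^ n) has_real_derivative
        (exp (- (1 / x)) * (1 / x\<^sup>2) * x ^ n - exp (- (1 / x)) * (real n * x ^ (n - 1))) / (x ^ n * x ^ n)) (at x)"
    proof (rule DERIV_divide)
      have "((\<lambda>x. 1 / x) has_real_derivative - (1 / x\<^sup>2)) (at x)"
        using DERIV_inverse[of x] 3 by (simp add: inverse_eq_divide numeral_2_eq_2)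
      then show "((\<lambda>x. exp (- (1 / x))) has_real_derivative exp (- (1 / x)) * (1 / x\<^sup>2)) (at x)"
        by (intro DERIV_fun_exp DERIV_minus[THEN DERIV_cong]) auto
    qed (use 3 in \<open>auto intro!: derivative_eq_intros\<close>)
    moreover have "(exp (- (1 / x)) * (1 / x\<^sup>2) * x ^ n - exp (- (1 / x)) * (real n * x ^ (n - 1))) / (x ^ n * x ^ n)
        = flat (n + 2) x - real n * flat (n + 1) x"
    proof -
      have "real n * x ^ (n - 1) / (x ^ n * x ^ n) = real n / x ^ (n + 1)"
        using 3 by (cases n) (simp_all add: divide_simps)
      moreover have "1 / x\<^sup>2 * x ^ n / (x ^ n * x ^ n) = 1 / x ^ (n + 2)"
        using 3 by (simp add: divide_simps power_add power2_eq_square)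
      moreover have "(e * q * X - e * y) / z = e * (q * X / z) - e * (y / z)" for e q X y z :: real
        by (simp add: diff_divide_distrib mult.assoc)
      ultimately show ?thesis
        using 3 by (simp only: flat_def if_True) (simp add: mult.commute)
    qed
    ultimately have "((\<lambda>x. exp (- (1 / x)) / x ^ n) has_real_derivative
        flat (n + 2) x - real n * flat (n + 1) x) (at x)" by simp
    moreover have "\<forall>\<^sub>F y in nhds x. flat n y = exp (- (1 / y)) / y ^ n"
      using eventually_nhds_in_open[of "{0<..}" x] 3 by (auto elim!: eventually_mono simp: flat_def)
    ultimately show ?thesis by (subst DERIV_cong_ev[OF refl _ refl]) auto
  qed
qed

text \<open>A class closed under differentiation, so that smoothness needs no formula for higher derivatives.\<close>

inductive flat_gen :: "(real \<Rightarrow> real) \<Rightarrow> bool" where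
  flat: "flat_gen (flat n)"
| affine: "flat_gen f \<Longrightarrow> flat_gen (\<lambda>x. f (c * x + d))"
| scale: "flat_gen f \<Longrightarrow> flat_gen (\<lambda>x. c * f x)"
| add: "flat_gen f \<Longrightarrow> flat_gen g \<Longrightarrow> flat_gen (\<lambda>x. f x + g x)"
| mult: "flat_gen f \<Longrightarrow> flat_gen g \<Longrightarrow> flat_gen (\<lambda>x. f x * g x)"
| inverse: "flat_gen f \<Longrightarrow> (\<And>x. f x \<noteq> 0) \<Longrightarrow> flat_gen (\<lambda>x. inverse (f x))"

lemma flat_gen_deriv:
  "flat_gen f \<Longrightarrow> \<exists>f'. flat_gen f' \<and> (\<forall>x. (f has_real_derivative f' x) (at x))"
proof (induction rule: flat_gen.induct)
  case (flat n)
  have "flat_gen (\<lambda>x. flat (n + 2) x + (- real n) * flat (n + 1) x)"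
    by (intro flat_gen.intros)
  then show ?case using flat_has_real_derivative[of n] by fastforce
next
  case (affine f c d)
  then obtain f' where f': "flat_gen f'" "\<And>x. (f has_real_derivative f' x) (at x)" by blast
  have "((\<lambda>x. f (c * x + d)) has_real_derivative c * f' (c * x + d)) (at x)" for x
    by (rule DERIV_chain2[OF f'(2), THEN DERIV_cong]) (auto intro!: derivative_eq_intros)
  then show ?case using f' by (blast intro: flat_gen.intros)
next
  case (scale f c)
  then show ?case by (blast intro: flat_gen.intros DERIV_cmult)
next
  case (add f g)
  then show ?case by (blast intro: flat_gen.intros DERIV_add)
next
  case (mult f g)
  then show ?case by (blast intro: flat_gen.intros DERIV_mult')
next
  case (inverse f)
  then obtain f' where f': "flat_gen f'" "\<And>x. (f has_real_derivative f' x) (at x)" by blast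
  have "((\<lambda>x. inverse (f x)) has_real_derivative
      (-1) * (f' x * (inverse (f x) * inverse (f x)))) (at x)" for x
    by (rule DERIV_inverse_fun[OF f'(2), THEN DERIV_cong]) (use inverse in \<open>auto\<close>)
  moreover have "flat_gen (\<lambda>x. (-1) * (f' x * (inverse (f x) * inverse (f x))))"
    using f' inverse by (intro flat_gen.intros) auto
  ultimately show ?case by blast
qed

text \<open>The iterates of a choice of derivative within the class form the sequence that
  \<open>smooth\<close> asks for.\<close>

lemma flat_gen_smooth:
  assumes "flat_gen f"
  shows "smooth f"
proof -
  define d where "d h = (SOME h'. flat_gen h' \<and> (\<forall>x. (h has_real_derivative h' x) (at x)))" for h
  have d: "flat_gen (d h) \<and> (\<forall>x. (h has_real_derivative d h x) (at x))" if "flat_gen h" for h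
    unfolding d_def using flat_gen_deriv[OF that] by (rule someI_ex)
  have "flat_gen ((d ^^ n) f)" for n by (induction n) (use d assms in auto)
  then show ?thesis unfolding smooth_def
    by (intro exI[of _ "\<lambda>n. (d ^^ n) f"]) (use d in auto)
qed

text \<open>The classical quotient e(x) / (e(x) + e(1 - x)) with e(x) = exp(-1/x) for x > 0. The
  argument is spelled \<open>- 1 * x + 1\<close> to fit the rule \<open>affine\<close> of
  \<open>flat_gen\<close>.\<close>

definition smooth_step :: "real \<Rightarrow> real" where
  "smooth_step x = flat 0 x * inverse (flat 0 x + flat 0 (- 1 * x + 1))"

lemma flat_0_sum_pos: "0 < flat 0 x + flat 0 (- 1 * x + 1)"
  by (auto simp: flat_def add_pos_nonneg add_nonneg_pos)

lemma flat_gen_smooth_step: "flat_gen smooth_step"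
  unfolding smooth_step_def[abs_def]
  by (intro flat_gen.intros) (use flat_0_sum_pos in \<open>auto simp: less_imp_neq[symmetric]\<close>)

lemma smooth_step_0: "x \<le> 0 \<Longrightarrow> smooth_step x = 0"
  by (simp add: smooth_step_def flat_def)

lemma smooth_step_1: "1 \<le> x \<Longrightarrow> smooth_step x = 1"
  by (simp add: smooth_step_def flat_def)

lemma smooth_step_bounds: "0 \<le> smooth_step x" "smooth_step x \<le> 1"
  using flat_0_sum_pos[of x] by (auto simp: smooth_step_def flat_def divide_simps)

text \<open>For x \<le> 0 the step is at its minimum and for x \<ge> 1 at its maximum, so the
  derivative vanishes there, including at 0 and 1. A bound on [0,1] is then a global one.\<close>

lemma smooth_step_deriv:
  obtains R' M where "\<And>x. (smooth_step has_real_derivative R' x) (at x)"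
    "continuous_on UNIV R'" "\<And>x. x \<le> 0 \<or> 1 \<le> x \<Longrightarrow> R' x = 0" "\<And>x. \<bar>R' x\<bar> \<le> M" "0 < M"
proof -
  obtain R' where R': "flat_gen R'" "\<And>x. (smooth_step has_real_derivative R' x) (at x)"
    using flat_gen_deriv[OF flat_gen_smooth_step] by blast
  obtain R'' where "\<And>x. (R' has_real_derivative R'' x) (at x)"
    using flat_gen_deriv[OF R'(1)] by blast
  then have cont: "continuous_on UNIV R'"
    by (meson DERIV_isCont continuous_at_imp_continuous_on)
  have zero: "R' x = 0" if "x \<le> 0 \<or> 1 \<le> x" for x
    using that
  proof
    assume "x \<le> 0"
    then show ?thesis
      using DERIV_local_min[OF R'(2)[of x], of 1] smooth_step_bounds smooth_step_0 by simp
  next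
    assume "1 \<le> x"
    then show ?thesis
      using DERIV_local_max[OF R'(2)[of x], of 1] smooth_step_bounds smooth_step_1 by simp
  qed
  have "compact (R' ` {0..1})"
    by (intro compact_continuous_image continuous_on_subset[OF cont]) auto
  then obtain M where M: "0 < M" "\<And>x. x \<in> {0..1} \<Longrightarrow> \<bar>R' x\<bar> \<le> M"
    using compact_imp_bounded bounded_pos[of "R' ` {0..1}"] by (auto simp: image_iff)
  have "\<bar>R' x\<bar> \<le> M" for x
    using M zero[of x] by (cases "x \<in> {0..1}") auto
  then show ?thesis using that R'(2) cont zero M(1) by blast
qed

section \<open>Functions with a square integrable weak derivative\<close>

text \<open>The kernel is the derivative of a rescaled step: it has integral exactly 1 and lives on
  [c, c + \<epsilon>], to the right of c.\<close>

lemma mollifier_tendsto: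
  fixes f R' :: "real \<Rightarrow> real"
  assumes f: "continuous_on {0..a} f" and c: "0 < c" "c < a"
    and R': "\<And>x. (smooth_step has_real_derivative R' x) (at x)"
    and cont: "continuous_on UNIV R'" and zero: "\<And>x. x \<le> 0 \<or> 1 \<le> x \<Longrightarrow> R' x = 0"
    and M: "\<And>x. \<bar>R' x\<bar> \<le> M" "0 < M"
  shows "((\<lambda>\<epsilon>. integral {0..a} (\<lambda>x. f x * (R' ((x - c) / \<epsilon>) / \<epsilon>))) \<longlongrightarrow> f c) (at_right 0)"
proof (rule tendstoI)
  fix e :: real assume e: "0 < e"
  \<comment> \<open>The kernel has no known sign, so it is only bounded by M / \<epsilon> on an
    interval of length \<epsilon>. The error is at most \<eta> M = e / 2.\<close>
  define \<eta> where "\<eta> = e / (2 * M)"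
  have \<eta>: "0 < \<eta>" using e M by (simp add: \<eta>_def)
  obtain \<delta> where \<delta>: "0 < \<delta>" "\<And>x. x \<in> {0..a} \<Longrightarrow> \<bar>x - c\<bar> < \<delta> \<Longrightarrow> \<bar>f x - f c\<bar> < \<eta>"
    using f c \<eta> unfolding continuous_on_iff dist_real_def
    by (metis atLeastAtMost_iff less_eq_real_def)
  have "dist (integral {0..a} (\<lambda>x. f x * (R' ((x - c) / \<epsilon>) / \<epsilon>))) (f c) < e"
    if eps: "0 < \<epsilon>" "\<epsilon> < min \<delta> (a - c)" for \<epsilon>
  proof -
    define \<rho> where "\<rho> x = R' ((x - c) / \<epsilon>) / \<epsilon>" for x
    have cont\<rho>: "continuous_on S \<rho>" for S
      unfolding \<rho>_def using eps
      by (intro continuous_intros continuous_on_compose2[OF cont]) auto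
    have \<rho>0: "\<rho> x = 0" if "x \<notin> {c..c + \<epsilon>}" for x
    proof -
      have "(x - c) / \<epsilon> \<le> 0 \<or> 1 \<le> (x - c) / \<epsilon>"
        using that eps(1) by (auto simp: divide_le_0_iff le_divide_eq)
      then show ?thesis unfolding \<rho>_def using zero by simp
    qed
    have "(\<rho> has_integral smooth_step ((a - c) / \<epsilon>) - smooth_step ((0 - c) / \<epsilon>)) {0..a}"
    proof (rule fundamental_theorem_of_calculus)
      show "((\<lambda>x. smooth_step ((x - c) / \<epsilon>)) has_vector_derivative \<rho> x) (at x within {0..a})" for x
        unfolding \<rho>_def has_real_derivative_iff_has_vector_derivative[symmetric]
        by (rule has_field_derivative_at_within, rule DERIV_chain2[OF R', THEN DERIV_cong])
          (use eps in \<open>auto intro!: derivative_eq_intros\<close>)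
    qed (use c in auto)
    then have 1: "(\<rho> has_integral 1) {0..a}"
      using smooth_step_1[of "(a - c) / \<epsilon>"] smooth_step_0[of "(0 - c) / \<epsilon>"] eps c
      by (simp add: divide_le_0_iff le_divide_eq)
    have f\<rho>: "(\<lambda>x. f x * \<rho> x) integrable_on {0..a}"
      by (intro integrable_continuous_interval continuous_intros f cont\<rho>)
    have sub: "{c..c + \<epsilon>} \<subseteq> {0..a}" using eps c by auto
    have int: "(\<lambda>x. (f x - f c) * \<rho> x) integrable_on {c..c + \<epsilon>}"
      by (intro integrable_continuous_interval continuous_intros cont\<rho> continuous_on_subset[OF f sub])
    have "integral {0..a} (\<lambda>x. (f x - f c) * \<rho> x) = integral {c..c + \<epsilon>} (\<lambda>x. (f x - f c) * \<rho> x)"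
      by (rule integral_unique, rule has_integral_on_superset[OF integrable_integral[OF int] _ sub])
        (use \<rho>0 in auto)
    moreover have "norm (integral {c..c + \<epsilon>} (\<lambda>x. (f x - f c) * \<rho> x)) \<le> \<eta> * (M / \<epsilon>) * ((c + \<epsilon>) - c)"
    proof (rule integral_bound)
      show "norm ((f x - f c) * \<rho> x) \<le> \<eta> * (M / \<epsilon>)" if "x \<in> {c..c + \<epsilon>}" for x
      proof -
        have "\<bar>f x - f c\<bar> \<le> \<eta>" using \<delta>(2)[of x] that eps sub by fastforce
        moreover have "\<bar>\<rho> x\<bar> \<le> M / \<epsilon>" unfolding \<rho>_def using M eps by (simp add: divide_right_mono)
        ultimately have "\<bar>f x - f c\<bar> * \<bar>\<rho> x\<bar> \<le> \<eta> * (M / \<epsilon>)"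
          using \<eta> by (intro mult_mono) auto
        then show ?thesis by (simp add: abs_mult)
      qed
    qed (use eps sub in \<open>auto intro!: continuous_intros cont\<rho> continuous_on_subset[OF f]\<close>)
    moreover have "integral {0..a} (\<lambda>x. (f x - f c) * \<rho> x) = integral {0..a} (\<lambda>x. f x * \<rho> x) - f c"
    proof -
      have "((\<lambda>x. f x * \<rho> x - f c * \<rho> x) has_integral
          integral {0..a} (\<lambda>x. f x * \<rho> x) - f c * 1) {0..a}"
        by (intro has_integral_diff integrable_integral f\<rho> has_integral_mult_right 1)
      then show ?thesis by (simp add: left_diff_distrib integral_unique)
    qed
    ultimately have "\<bar>integral {0..a} (\<lambda>x. f x * \<rho> x) - f c\<bar> \<le> \<eta> * M"
      using eps by simp
    also have "\<dots> < e" using e M by (simp add: \<eta>_def)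
    finally show ?thesis by (simp add: \<rho>_def dist_real_def)
  qed
  then show "\<forall>\<^sub>F \<epsilon> in at_right 0. dist (integral {0..a} (\<lambda>x. f x * (R' ((x - c) / \<epsilon>) / \<epsilon>))) (f c) < e"
    using \<delta>(1) c by (auto simp: eventually_at_right_field intro!: exI[of _ "min \<delta> (a - c)"])
qed

text \<open>The interval is bounded, so 1 + g^2 is integrable, and it dominates |g|.\<close>

lemma square_integrable_imp_set_integrable:
  assumes "square_integrable a g"
  shows "set_integrable lborel {0<..<a} g"
proof -
  have "set_integrable lborel {0<..<a} (\<lambda>x. 1 + (g x)\<^sup>2)"
  proof (rule set_integral_add)
    show "set_integrable lborel {0<..<a} (\<lambda>x. 1::real)"
      by (rule set_integrable_subset[OF borel_integrable_atLeastAtMost'[of 0 a]]) auto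
  qed (use assms in \<open>simp add: square_integrable_def\<close>)
  then show ?thesis
  proof (rule set_integrable_bound)
    show "set_borel_measurable lborel {0<..<a} g"
      using assms by (simp add: square_integrable_def)
    have "\<bar>y\<bar> \<le> \<bar>1 + y\<^sup>2\<bar>" for y :: real
    proof -
      have "0 \<le> (\<bar>y\<bar> - 1)\<^sup>2" by simp
      then have "2 * \<bar>y\<bar> \<le> 1 + y\<^sup>2" by (simp add: power2_diff)
      then show ?thesis by linarith
    qed
    then show "AE x in lborel. x \<in> {0<..<a} \<longrightarrow> norm (g x) \<le> norm (1 + (g x)\<^sup>2)" by simp
  qed
qed

text \<open>The test functions are differences of two rescaled steps, one climbing from \<open>0\<close> to \<open>1\<close> to the
  right of \<open>c\<close> and one to the right of \<open>d\<close>; they tend to the indicator of \<open>{c<..d}\<close>.\<close>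

lemma weak_deriv_increment:
  assumes f: "continuous_on {0..a} f" and g: "square_integrable a g"
    and wd: "is_weak_deriv a f g" and cd: "0 < c" "c < d" "d < a"
  shows "f d - f c = integral {c..d} g"
proof -
  obtain R' M where R': "\<And>x. (smooth_step has_real_derivative R' x) (at x)"
    and contR': "continuous_on UNIV R'" and zero: "\<And>x. x \<le> 0 \<or> 1 \<le> x \<Longrightarrow> R' x = 0"
    and M: "\<And>x. \<bar>R' x\<bar> \<le> M" "0 < M"
    using smooth_step_deriv by metis
  \<comment> \<open>The support [c, d + \<epsilon> k] must stay strictly inside (0,a). The shift by
    2 gives \<open>\<epsilon> k < a - d\<close> already at k = 0.\<close>
  define \<epsilon> where "\<epsilon> k = (a - d) / real (k + 2)" for k
  have eps: "0 < \<epsilon> k" "\<epsilon> k < a - d" for k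
  proof -
    have "(a - d) * 1 < (a - d) * real (k + 2)"
      using cd by (intro mult_strict_left_mono) auto
    then show "0 < \<epsilon> k" "\<epsilon> k < a - d"
      using cd by (auto simp: \<epsilon>_def divide_less_eq)
  qed
  have "\<epsilon> \<longlonglongrightarrow> 0"
    unfolding \<epsilon>_def using LIMSEQ_ignore_initial_segment[OF lim_const_over_n[of "a - d"], of 2] by simp
  then have lim\<epsilon>: "filterlim \<epsilon> (at_right 0) sequentially"
    using eps(1) by (simp add: filterlim_at less_imp_neq[symmetric])
  define \<phi> where "\<phi> k x = smooth_step ((x - c) / \<epsilon> k) - smooth_step ((x - d) / \<epsilon> k)" for k x
  define \<phi>' where "\<phi>' k x = R' ((x - c) / \<epsilon> k) / \<epsilon> k - R' ((x - d) / \<epsilon> k) / \<epsilon> k" for k x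
  have deriv: "(\<phi> k has_real_derivative \<phi>' k x) (at x)" for k x
    unfolding \<phi>_def \<phi>'_def using eps[of k]
    by (intro DERIV_diff; intro DERIV_chain2[OF R', THEN DERIV_cong])
      (auto intro!: derivative_eq_intros)
  have test: "test_function a (\<phi> k)" for k
  proof -
    have eq: "\<phi> k = (\<lambda>x. smooth_step ((1 / \<epsilon> k) * x + (- c / \<epsilon> k)) +
        (-1) * smooth_step ((1 / \<epsilon> k) * x + (- d / \<epsilon> k)))"
      by (auto simp: \<phi>_def diff_divide_distrib)
    have "smooth (\<phi> k)"
      unfolding eq by (intro flat_gen_smooth flat_gen.add flat_gen.scale flat_gen.affine flat_gen_smooth_step)
    moreover have "closure {x. \<phi> k x \<noteq> 0} \<subseteq> {c..d + \<epsilon> k}"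
    proof (rule closure_minimal)
      have "\<phi> k x = 0" if "x \<notin> {c..d + \<epsilon> k}" for x
      proof (cases "x < c")
        case True
        then have "(x - c) / \<epsilon> k \<le> 0" "(x - d) / \<epsilon> k \<le> 0"
          using cd eps[of k] by (auto simp: divide_le_0_iff)
        then show ?thesis by (simp add: \<phi>_def smooth_step_0)
      next
        case False
        then have "1 \<le> (x - c) / \<epsilon> k" "1 \<le> (x - d) / \<epsilon> k"
          using that cd eps[of k] by (auto simp: le_divide_eq)
        then show ?thesis by (simp add: \<phi>_def smooth_step_1)
      qed
      then show "{x. \<phi> k x \<noteq> 0} \<subseteq> {c..d + \<epsilon> k}" by blast
    qed auto
    ultimately show ?thesis
      using cd eps[of k] by (force simp: test_function_def)
  qed
  have "(LBINT x:{0<..<a}. f x * deriv (\<phi> k) x) =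
      integral {0..a} (\<lambda>x. f x * (R' ((x - c) / \<epsilon> k) / \<epsilon> k)) -
      integral {0..a} (\<lambda>x. f x * (R' ((x - d) / \<epsilon> k) / \<epsilon> k))" for k
  proof -
    have cR: "continuous_on S (\<lambda>x. R' ((x - y) / \<epsilon> k) / \<epsilon> k)" for S y
      using eps[of k] by (intro continuous_intros continuous_on_compose2[OF contR']) auto
    have "deriv (\<phi> k) = \<phi>' k" using deriv by (auto intro: DERIV_imp_deriv)
    moreover have "set_integrable lborel {0..a} (\<lambda>x. f x * \<phi>' k x)"
      unfolding \<phi>'_def by (intro borel_integrable_atLeastAtMost' continuous_intros f cR)
    then have "set_integrable lborel {0<..<a} (\<lambda>x. f x * \<phi>' k x)"
      by (rule set_integrable_subset) auto
    ultimately have "(LBINT x:{0<..<a}. f x * deriv (\<phi> k) x) = integral {0<..<a} (\<lambda>x. f x * \<phi>' k x)"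
      by (simp add: set_borel_integral_eq_integral)
    also have "\<dots> = integral {0..a} (\<lambda>x. f x * \<phi>' k x)"
      by (rule integral_open_interval_real[symmetric])
    also have "\<dots> = integral {0..a} (\<lambda>x. f x * (R' ((x - c) / \<epsilon> k) / \<epsilon> k)) -
      integral {0..a} (\<lambda>x. f x * (R' ((x - d) / \<epsilon> k) / \<epsilon> k))"
      unfolding \<phi>'_def right_diff_distrib
      by (intro integral_diff integrable_continuous_interval continuous_intros f cR)
    finally show ?thesis .
  qed
  moreover have "(\<lambda>k. integral {0..a} (\<lambda>x. f x * (R' ((x - y) / \<epsilon> k) / \<epsilon> k))) \<longlonglongrightarrow> f y"
    if "0 < y" "y < a" for y
    by (rule filterlim_compose[OF mollifier_tendsto[OF f that R' contR' zero M] lim\<epsilon>])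
  ultimately have lim1: "(\<lambda>k. LBINT x:{0<..<a}. f x * deriv (\<phi> k) x) \<longlonglongrightarrow> f c - f d"
    using cd by (auto intro!: tendsto_diff)
  have gi: "set_integrable lborel {0<..<a} g"
    by (rule square_integrable_imp_set_integrable[OF g])
  have step_lim: "(\<lambda>k. smooth_step ((x - y) / \<epsilon> k)) \<longlonglongrightarrow> indicator {y<..} x" for x y
  proof (cases "y < x")
    case True
    have "\<forall>\<^sub>F k in sequentially. \<epsilon> k < x - y"
      using order_tendstoD(2)[OF \<open>\<epsilon> \<longlonglongrightarrow> 0\<close>, of "x - y"] True by simp
    then have "\<forall>\<^sub>F k in sequentially. smooth_step ((x - y) / \<epsilon> k) = indicator {y<..} x"
      by eventually_elim (use True eps in \<open>auto intro!: smooth_step_1 simp: le_divide_eq\<close>)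
    then show ?thesis by (rule tendsto_eventually)
  next
    case False
    then have "smooth_step ((x - y) / \<epsilon> k) = indicator {y<..} x" for k
      using eps(1)[of k] by (auto intro!: smooth_step_0 simp: divide_le_0_iff)
    then show ?thesis by simp
  qed
  have meas: "\<phi> k \<in> borel_measurable borel" for k
    by (intro borel_measurable_continuous_onI continuous_at_imp_continuous_on)
      (use deriv in \<open>auto intro: DERIV_isCont\<close>)
  \<comment> \<open>The mollifier limit needs continuity, which \<open>f\<close> has but
    \<open>g\<close> lacks. On this side the steps themselves converge pointwise and are bounded, so
    dominated convergence applies.\<close>
  have "(\<lambda>k. LBINT x:{0<..<a}. g x * \<phi> k x) \<longlonglongrightarrow> (LBINT x:{0<..<a}. g x * indicator {c<..d} x)"
    unfolding set_lebesgue_integral_def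
  proof (rule integral_dominated_convergence)
    show "integrable lborel (\<lambda>x. 2 * norm (indicator {0<..<a} x *\<^sub>R g x))"
      using gi unfolding set_integrable_def by (intro integrable_mult_right integrable_norm)
    have gm: "(\<lambda>x. indicator {0<..<a} x *\<^sub>R g x) \<in> borel_measurable lborel"
      using g by (simp add: square_integrable_def set_borel_measurable_def)
    have "(\<lambda>x. (indicator {0<..<a} x *\<^sub>R g x) * indicator {c<..d} x) \<in> borel_measurable lborel"
      using gm by (intro borel_measurable_times) auto
    then show "(\<lambda>x. indicator {0<..<a} x *\<^sub>R (g x * indicator {c<..d} x)) \<in> borel_measurable lborel"
      by (simp add: mult.assoc)
    show "(\<lambda>x. indicator {0<..<a} x *\<^sub>R (g x * \<phi> k x)) \<in> borel_measurable lborel" for k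
    proof -
      have "(\<lambda>x. (indicator {0<..<a} x *\<^sub>R g x) * \<phi> k x) \<in> borel_measurable lborel"
        using gm meas[of k] by (intro borel_measurable_times) auto
      then show ?thesis by (simp add: mult.assoc)
    qed
    have "(indicator {c<..d} x :: real) = indicator {c<..} x - indicator {d<..} x" for x
      using cd by (auto simp: indicator_def)
    then show "AE x in lborel. (\<lambda>k. indicator {0<..<a} x *\<^sub>R (g x * \<phi> k x)) \<longlonglongrightarrow>
        indicator {0<..<a} x *\<^sub>R (g x * indicator {c<..d} x)"
      unfolding \<phi>_def by (intro AE_I2) (auto intro!: tendsto_intros step_lim)
    have "\<bar>\<phi> k x\<bar> \<le> 2" for k x
      unfolding \<phi>_def using smooth_step_bounds[of "(x - c) / \<epsilon> k"] smooth_step_bounds[of "(x - d) / \<epsilon> k"]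
      by linarith
    then have "\<bar>g x\<bar> * \<bar>\<phi> k x\<bar> \<le> \<bar>g x\<bar> * 2" for k x
      by (intro mult_left_mono) auto
    then show "AE x in lborel. norm (indicator {0<..<a} x *\<^sub>R (g x * \<phi> k x))
        \<le> 2 * norm (indicator {0<..<a} x *\<^sub>R g x)" for k
      by (intro AE_I2) (auto simp: indicator_def abs_mult mult.commute)
  qed
  moreover have "(LBINT x:{0<..<a}. f x * deriv (\<phi> k) x) = - (LBINT x:{0<..<a}. g x * \<phi> k x)" for k
    using wd test unfolding is_weak_deriv_def by blast
  ultimately have "(\<lambda>k. LBINT x:{0<..<a}. f x * deriv (\<phi> k) x) \<longlonglongrightarrow>
      - (LBINT x:{0<..<a}. g x * indicator {c<..d} x)"
    by (auto intro: tendsto_minus)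
  then have "f d - f c = (LBINT x:{0<..<a}. g x * indicator {c<..d} x)"
    using LIMSEQ_unique[OF lim1] by fastforce
  also have "\<dots> = (LBINT x:{c<..d}. g x)"
    unfolding set_lebesgue_integral_def using cd
    by (intro Bochner_Integration.integral_cong) (auto simp: indicator_def)
  also have "\<dots> = integral {c<..d} g"
    by (intro set_borel_integral_eq_integral(2) set_integrable_subset[OF gi]) (use cd in auto)
  also have "\<dots> = integral {c..d} g"
    by (rule integral_subset_negligible) (auto intro: negligible_subset[OF negligible_sing[of c]])
  finally show ?thesis .
qed

section \<open>Integration by parts against C^1 functions and the Dirichlet integral\<close>

lemma square_integrable_imp_absolutely_integrable:
  assumes "square_integrable a g"
  shows "g absolutely_integrable_on {0..a}"
proof -
  note int = square_integrable_imp_set_integrable[OF assms]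
  have "g integrable_on {0<..<a}" "(\<lambda>x. norm (g x)) integrable_on {0<..<a}"
    using set_borel_integral_eq_integral(1)[OF int]
      set_borel_integral_eq_integral(1)[OF set_integrable_abs[OF int]] by simp_all
  then show ?thesis
    unfolding absolutely_integrable_on_Icc_iff_Ioo by (rule absolutely_integrable_onI)
qed

lemma absolutely_integrable_continuous_mult:
  fixes g \<phi> :: "real \<Rightarrow> real"
  assumes "g absolutely_integrable_on {a..b}" "continuous_on {a..b} \<phi>"
  shows "(\<lambda>x. g x * \<phi> x) absolutely_integrable_on {a..b}"
proof -
  have "(\<lambda>x. \<phi> x * g x) absolutely_integrable_on {a..b}"
    by (intro absolutely_integrable_bounded_measurable_product_real assms
        continuous_imp_measurable_on_sets_lebesgue compact_imp_bounded compact_continuous_image) auto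
  then show ?thesis by (simp add: mult.commute)
qed

text \<open>Compact support of the test functions restricts the increment formula to interior
  points. The difference of \<open>f\<close> and the indefinite integral of \<open>g\<close> is
  continuous on [0,a], so its constancy in the interior extends to both ends.\<close>

lemma weak_deriv_indefinite_integral:
  assumes a: "0 < a" and f: "continuous_on {0..a} f" and g: "square_integrable a g"
    and wd: "is_weak_deriv a f g" and st: "0 \<le> s" "s \<le> t" "t \<le> a"
  shows "f t - f s = integral {s..t} g"
proof -
  have gi: "g integrable_on {0..a}"
    using square_integrable_imp_absolutely_integrable[OF g] by (simp add: absolutely_integrable_on_def)
  define G where "G x = f x - integral {0..x} g" for x
  have split: "integral {0..y} g - integral {0..x} g = integral {x..y} g" if "0 \<le> x" "x \<le> y" "y \<le> a" for x y
    using Henstock_Kurzweil_Integration.integral_combine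
      [OF that(1,2) integrable_subinterval_real[OF gi, of 0 y]] that by auto
  have G: "G x = G (a / 2)" if x: "x \<in> {0..a}" for x
  proof (rule continuous_constant_on_closure[where S = "{0<..<a}" and f = G])
    show "continuous_on (closure {0<..<a}) G"
      unfolding G_def using a by (auto intro!: continuous_intros f indefinite_integral_continuous_1 gi)
    show "x \<in> closure {0<..<a}" using a x by simp
    fix y assume "y \<in> {0<..<a}"
    then consider "y < a / 2" | "y = a / 2" | "a / 2 < y" by linarith
    then show "G y = G (a / 2)"
    proof cases
      case 1
      then show ?thesis using \<open>y \<in> _\<close> a
        using weak_deriv_increment[OF f g wd, of y "a / 2"] split[of y "a / 2"] by (simp add: G_def)
    next
      case 2
      then show ?thesis by (rule arg_cong)
    next
      case 3
      then show ?thesis using \<open>y \<in> _\<close> a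
        using weak_deriv_increment[OF f g wd, of "a / 2" y] split[of "a / 2" y] by (simp add: G_def)
    qed
  qed
  show ?thesis
    using G[of s] G[of t] split[of s t] st by (simp add: G_def)
qed

text \<open>Neither \<open>f\<close> nor the indefinite integral \<open>Q\<close> of \<open>g \<phi>\<close> need be differentiable, but \<open>Q - f \<phi>\<close> is.\<close>

lemma weak_deriv_by_parts:
  assumes a: "0 < a" and f: "continuous_on {0..a} f" and g: "square_integrable a g"
    and wd: "is_weak_deriv a f g"
    and \<phi>: "\<And>x. x \<in> {0..a} \<Longrightarrow> (\<phi> has_real_derivative \<phi>' x) (at x within {0..a})"
    and \<phi>': "continuous_on {0..a} \<phi>'" and bc: "\<phi> 0 = 0" "\<phi> a = 0"
  shows "integral {0..a} (\<lambda>x. g x * \<phi> x) = - integral {0..a} (\<lambda>x. f x * \<phi>' x)"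
proof -
  have gai: "g absolutely_integrable_on {0..a}"
    by (rule square_integrable_imp_absolutely_integrable[OF g])
  have cont: "continuous_on {0..a} \<phi>"
    using \<phi> by (rule DERIV_continuous_on)
  have gi: "g integrable_on {0..a}" and agi: "(\<lambda>x. \<bar>g x\<bar>) integrable_on {0..a}"
    using gai by (simp_all add: absolutely_integrable_on_def)
  have gpi: "(\<lambda>x. g x * \<phi> x) integrable_on {0..a}"
    using absolutely_integrable_continuous_mult[OF gai cont] by (simp add: absolutely_integrable_on_def)
  obtain L where L: "\<And>x. x \<in> {0..a} \<Longrightarrow> \<bar>\<phi>' x\<bar> \<le> L"
    using compact_imp_bounded[OF compact_continuous_image[OF \<phi>' compact_Icc]]
    by (auto simp only: bounded_iff ball_simps real_norm_def)
  then have "0 \<le> L" using a by (metis abs_ge_zero atLeastAtMost_iff less_eq_real_def order_trans)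
  have lip: "\<bar>\<phi> x - \<phi> y\<bar> \<le> L * \<bar>x - y\<bar>" if "x \<in> {0..a}" "y \<in> {0..a}" for x y
    using field_differentiable_bound[of "{0..a}" \<phi> \<phi>' L x y] \<phi> L that by simp
  \<comment> \<open>\<open>A\<close> is continuous because \<open>g\<close> is integrable. This is
    what makes the error below o(t - s).\<close>
  define A where "A x = integral {0..x} (\<lambda>x. \<bar>g x\<bar>)" for x
  define Q where "Q x = integral {0..x} (\<lambda>x. g x * \<phi> x)" for x
  have split: "integral {0..t} h - integral {0..s} h = integral {s..t} h"
    if "h integrable_on {0..a}" "0 \<le> s" "s \<le> t" "t \<le> a" for h :: "real \<Rightarrow> real" and s t
    using Henstock_Kurzweil_Integration.integral_combine
      [OF that(2,3) integrable_subinterval_real[OF that(1), of 0 t]] that by auto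
  \<comment> \<open>The increment of \<open>f\<close> is an integral of \<open>g\<close>, so
    freezing \<phi> at z costs only the oscillation of \<phi> times the integral of |g|. A free z
    lets \<phi> be taken at either end, as needed on the two sides of a point.\<close>
  have err: "\<bar>Q t - Q s - (f t - f s) * \<phi> z\<bar> \<le> L * (t - s) * (A t - A s)"
    if st: "0 \<le> s" "s \<le> t" "t \<le> a" and z: "s \<le> z" "z \<le> t" for s t z
  proof -
    have sub: "{s..t} \<subseteq> {0..a}" using st by auto
    note int = gi[THEN integrable_subinterval_real, OF sub]
      agi[THEN integrable_subinterval_real, OF sub] gpi[THEN integrable_subinterval_real, OF sub]
    have "Q t - Q s - (f t - f s) * \<phi> z = integral {s..t} (\<lambda>x. g x * \<phi> x) - integral {s..t} (\<lambda>x. g x * \<phi> z)"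
      unfolding Q_def by (simp add: split[OF gpi st] weak_deriv_indefinite_integral[OF a f g wd st])
    also have "\<dots> = integral {s..t} (\<lambda>x. g x * (\<phi> x - \<phi> z))"
      using int by (subst integral_diff[symmetric])
        (auto intro: integrable_on_mult_left simp: right_diff_distrib)
    also have "norm \<dots> \<le> integral {s..t} (\<lambda>x. L * (t - s) * \<bar>g x\<bar>)"
    proof (rule Henstock_Kurzweil_Integration.integral_norm_bound_integral)
      have "(\<lambda>x. g x * \<phi> x - g x * \<phi> z) integrable_on {s..t}"
        using int by (intro integrable_diff integrable_on_mult_left)
      then show "(\<lambda>x. g x * (\<phi> x - \<phi> z)) integrable_on {s..t}"
        by (simp add: right_diff_distrib)
      show "(\<lambda>x. L * (t - s) * \<bar>g x\<bar>) integrable_on {s..t}"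
        using int by (intro integrable_on_mult_right)
      fix x assume x: "x \<in> {s..t}"
      have "\<bar>\<phi> x - \<phi> z\<bar> \<le> L * \<bar>x - z\<bar>" using lip[of x z] x z sub by auto
      also have "\<dots> \<le> L * (t - s)" using x z \<open>0 \<le> L\<close> by (intro mult_left_mono) auto
      finally have "\<bar>g x\<bar> * \<bar>\<phi> x - \<phi> z\<bar> \<le> \<bar>g x\<bar> * (L * (t - s))" by (intro mult_left_mono) auto
      then show "norm (g x * (\<phi> x - \<phi> z)) \<le> L * (t - s) * \<bar>g x\<bar>"
        by (simp add: abs_mult mult.commute)
    qed
    also have "\<dots> = L * (t - s) * (A t - A s)"
      unfolding A_def by (simp add: split[OF agi st])
    finally show ?thesis by simp
  qed
  define F where "F x = integral {0..x} (\<lambda>x. f x * \<phi>' x)" for x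
  have "((\<lambda>y. Q y - f y * \<phi> y + F y) has_real_derivative 0) (at x within {0..a})"
    if x: "x \<in> {0..a}" for x
  proof -
    \<comment> \<open>\<open>Q y - f y * \<phi> y\<close> equals
      \<open>e y + Q x - f x * \<phi> y\<close>, in which \<open>f\<close> survives only as the
      constant \<open>f x\<close>. Since \<open>e\<close> has derivative 0 at x, only \<phi> is
      really differentiated.\<close>
    define e where "e y = Q y - Q x - (f y - f x) * \<phi> y" for y
    have "(e has_real_derivative 0) (at x within {0..a})"
      unfolding has_field_derivative_iff
    proof (rule Lim_null_comparison)
      have "norm ((e y - e x) / (y - x)) \<le> L * \<bar>A y - A x\<bar>" if y: "y \<in> {0..a}" "y \<noteq> x" for y
      proof -
        have "\<bar>e y\<bar> \<le> L * \<bar>A y - A x\<bar> * \<bar>y - x\<bar>"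
        proof (cases "x < y")
          case True
          have "\<bar>e y\<bar> \<le> L * (y - x) * (A y - A x)"
            using err[of x y y] True x y by (simp add: e_def)
          also have "\<dots> \<le> L * (y - x) * \<bar>A y - A x\<bar>"
            using True \<open>0 \<le> L\<close> by (intro mult_left_mono) auto
          finally show ?thesis using True by (simp add: mult_ac)
        next
          case False
          have "\<bar>e y\<bar> = \<bar>Q x - Q y - (f x - f y) * \<phi> y\<bar>" unfolding e_def by (simp add: left_diff_distrib)
          also have "\<dots> \<le> L * (x - y) * (A x - A y)"
            using err[of y x y] False x y by simp
          also have "\<dots> \<le> L * (x - y) * \<bar>A y - A x\<bar>"
            using False \<open>0 \<le> L\<close> by (intro mult_left_mono) auto
          finally show ?thesis using False by (simp add: mult_ac)
        qed
        moreover have "e x = 0" by (simp add: e_def)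
        ultimately show ?thesis using y by (simp add: abs_divide divide_le_eq)
      qed
      then show "\<forall>\<^sub>F y in at x within {0..a}. norm ((e y - e x) / (y - x)) \<le> L * \<bar>A y - A x\<bar>"
        by (auto simp: eventually_at_filter)
      have "(A \<longlongrightarrow> A x) (at x within {0..a})"
        using indefinite_integral_continuous_1[OF agi] x unfolding A_def[abs_def] continuous_on_def by blast
      then have "((\<lambda>y. L * \<bar>A y - A x\<bar>) \<longlongrightarrow> L * \<bar>A x - A x\<bar>) (at x within {0..a})"
        by (intro tendsto_intros)
      then show "((\<lambda>y. L * \<bar>A y - A x\<bar>) \<longlongrightarrow> 0) (at x within {0..a})" by simp
    qed
    moreover have "(F has_real_derivative f x * \<phi>' x) (at x within {0..a})"
      unfolding F_def[abs_def] using x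
      by (intro integral_has_real_derivative continuous_intros f \<phi>')
    ultimately have "((\<lambda>y. e y + Q x - f x * \<phi> y + F y) has_real_derivative
        0 + 0 - f x * \<phi>' x + f x * \<phi>' x) (at x within {0..a})"
      by (intro DERIV_add DERIV_diff DERIV_const DERIV_cmult \<phi> x)
    then show ?thesis by (simp add: e_def algebra_simps)
  qed
  then obtain c where c: "\<And>x. x \<in> {0..a} \<Longrightarrow> Q x - f x * \<phi> x + F x = c"
    using has_field_derivative_zero_constant[of "{0..a}" "\<lambda>y. Q y - f y * \<phi> y + F y"] by auto
  have "Q a + F a = Q 0 + F 0"
    using c[of 0] c[of a] a bc by simp
  then show ?thesis by (simp add: Q_def F_def)
qed

lemma square_integrable_imp_integrable_power2:
  assumes "square_integrable a g"
  shows "(\<lambda>x. (g x)\<^sup>2) integrable_on {0..a}"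
  unfolding integrable_on_Icc_iff_Ioo
  using assms by (intro set_borel_integral_eq_integral) (simp add: square_integrable_def)

text \<open>Expand the integral of (g - \<phi>)^2 \<ge> 0 and move the derivative from
  \<open>f\<close> onto \<phi>. This is the tangent bound for a convex functional, with the linear
  term depending on \<open>f\<close> alone.\<close>

lemma weak_deriv_dirichlet_ge:
  assumes a: "0 < a" and f: "continuous_on {0..a} f" and g: "square_integrable a g"
    and wd: "is_weak_deriv a f g"
    and \<phi>: "\<And>x. x \<in> {0..a} \<Longrightarrow> (\<phi> has_real_derivative \<phi>' x) (at x within {0..a})"
    and \<phi>': "continuous_on {0..a} \<phi>'" and bc: "\<phi> 0 = 0" "\<phi> a = 0"
  shows "- 2 * integral {0..a} (\<lambda>x. f x * \<phi>' x) - integral {0..a} (\<lambda>x. (\<phi> x)\<^sup>2)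
    \<le> integral {0..a} (\<lambda>x. (g x)\<^sup>2)"
proof -
  have cont: "continuous_on {0..a} \<phi>"
    using \<phi> by (rule DERIV_continuous_on)
  have "(\<lambda>x. g x * \<phi> x) integrable_on {0..a}"
    using absolutely_integrable_continuous_mult[OF square_integrable_imp_absolutely_integrable[OF g] cont]
    by (simp add: absolutely_integrable_on_def)
  moreover have "(\<lambda>x. (\<phi> x)\<^sup>2) integrable_on {0..a}"
    by (intro integrable_continuous_interval continuous_intros cont)
  moreover note square_integrable_imp_integrable_power2[OF g]
  ultimately have "((\<lambda>x. (g x)\<^sup>2 - 2 * (g x * \<phi> x) + (\<phi> x)\<^sup>2) has_integral
      integral {0..a} (\<lambda>x. (g x)\<^sup>2) - 2 * integral {0..a} (\<lambda>x. g x * \<phi> x) + integral {0..a} (\<lambda>x. (\<phi> x)\<^sup>2)) {0..a}"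
    by (intro has_integral_add has_integral_diff has_integral_mult_right integrable_integral)
  then have "0 \<le> integral {0..a} (\<lambda>x. (g x)\<^sup>2) - 2 * integral {0..a} (\<lambda>x. g x * \<phi> x) + integral {0..a} (\<lambda>x. (\<phi> x)\<^sup>2)"
  proof (rule has_integral_nonneg)
    show "0 \<le> (g x)\<^sup>2 - 2 * (g x * \<phi> x) + (\<phi> x)\<^sup>2" for x
      using zero_le_power2[of "g x - \<phi> x"] by (simp add: power2_diff mult.assoc)
  qed
  then show ?thesis
    using weak_deriv_by_parts[OF assms] by simp
qed

text \<open>The energy is infinite outside H^1, so the choice made in \<open>weak_deriv\<close> has
  a genuine witness. Continuity of \<open>f\<close> lets the integral of the difference be
  split.\<close>

lemma energy_less_top:
  assumes "energy a f < \<infinity>" and f: "continuous_on {0..a} f"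
  obtains g where "square_integrable a g" "is_weak_deriv a f g"
    "energy a f = ereal (integral {0..a} (\<lambda>x. (g x)\<^sup>2) - integral {0..a} (\<lambda>x. (f x - mean a f)\<^sup>2))"
proof -
  have H1: "f \<in> H1 a" using assms by (auto simp: energy_def split: if_splits)
  define g where "g = weak_deriv a f"
  have "\<exists>g. square_integrable a g \<and> is_weak_deriv a f g"
    using H1 by (simp add: H1_def)
  from someI_ex[OF this] have g: "square_integrable a g" "is_weak_deriv a f g"
    by (simp_all add: g_def weak_deriv_def)
  \<comment> \<open>Square integrability concerns the open interval only; adding its two end points
    changes nothing.\<close>
  have g2: "set_integrable lborel {0..a} (\<lambda>x. (g x)\<^sup>2)"
    using g(1) unfolding square_integrable_def
    by (subst set_integrable_discrete_difference[where B = "{0<..<a}" and X = "{0, a}"]) auto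
  have f2: "set_integrable lborel {0..a} (\<lambda>x. (f x - mean a f)\<^sup>2)"
    by (intro borel_integrable_atLeastAtMost' continuous_intros f)
  have "energy a f = ereal (LBINT x:{0..a}. (g x)\<^sup>2 - (f x - mean a f)\<^sup>2)"
    using H1 by (simp add: energy_def g_def)
  also have "(LBINT x:{0..a}. (g x)\<^sup>2 - (f x - mean a f)\<^sup>2) =
      integral {0..a} (\<lambda>x. (g x)\<^sup>2) - integral {0..a} (\<lambda>x. (f x - mean a f)\<^sup>2)"
    using set_integral_diff(2)[OF g2 f2] set_borel_integral_eq_integral(2)[OF g2]
      set_borel_integral_eq_integral(2)[OF f2] by simp
  finally show ?thesis using that g by blast
qed

text \<open>These integrate s^(-p) (s - v) in s. At p = 2 the first primitive is a logarithm; the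
  exponent 1 - p of the second never vanishes.\<close>

lemma powr_primitives:
  fixes p :: real
  assumes "1 < p"
  obtains N M where
    "\<And>s. 0 < s \<Longrightarrow> (N has_real_derivative s powr (1 - p)) (at s)"
    "\<And>s. 0 < s \<Longrightarrow> (M has_real_derivative s powr (- p)) (at s)"
proof -
  define N where "N s = (if p = 2 then ln s else s powr (2 - p) / (2 - p))" for s
  have "(N has_real_derivative s powr (1 - p)) (at s)" if s: "0 < s" for s
  proof (cases "p = 2")
    case True
    have "(ln has_real_derivative s powr (- 1)) (at s)"
      using DERIV_ln[OF s] s by (simp add: powr_minus)
    then show ?thesis using True by (simp add: N_def[abs_def])
  next
    case False
    have "((\<lambda>s. s powr (2 - p) / (2 - p)) has_real_derivative (2 - p) * s powr (2 - p - 1) / (2 - p)) (at s)"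
      by (intro DERIV_cdivide has_real_derivative_powr s)
    then show ?thesis using False by (simp add: N_def[abs_def])
  qed
  moreover have "((\<lambda>s. s powr (1 - p) / (1 - p)) has_real_derivative s powr (- p)) (at s)"
    if s: "0 < s" for s
  proof -
    have "((\<lambda>s. s powr (1 - p) / (1 - p)) has_real_derivative (1 - p) * s powr (1 - p - 1) / (1 - p)) (at s)"
      by (intro DERIV_cdivide has_real_derivative_powr s)
    then show ?thesis using assms by simp
  qed
  ultimately show ?thesis using that by blast
qed

section \<open>Global solutions\<close>

text \<open>A classical solution for \<open>T = \<infinity>\<close>, with the existentially
  quantified derivatives fixed so that functionals can refer to them.\<close>

locale global_solution =
  fixes p a :: real and u ut ux uxx :: "real \<Rightarrow> real \<Rightarrow> real"
  assumes p: "1 < p" and a: "0 < a"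
    and cont_u: "continuous_on ({0..} \<times> {0..a}) (\<lambda>(t, x). u t x)"
    and pos: "0 \<le> t \<Longrightarrow> x \<in> {0..a} \<Longrightarrow> 0 < u t x"
    and cont_ut: "continuous_on ({0<..} \<times> {0..a}) (\<lambda>(t, x). ut t x)"
    and cont_ux: "continuous_on ({0<..} \<times> {0..a}) (\<lambda>(t, x). ux t x)"
    and cont_uxx: "continuous_on ({0<..} \<times> {0..a}) (\<lambda>(t, x). uxx t x)"
    and deriv_t: "0 < t \<Longrightarrow> x \<in> {0..a} \<Longrightarrow> ((\<lambda>s. u s x) has_real_derivative ut t x) (at t)"
    and deriv_x: "0 < t \<Longrightarrow> x \<in> {0..a} \<Longrightarrow> (u t has_real_derivative ux t x) (at x within {0..a})"
    and deriv_xx: "0 < t \<Longrightarrow> x \<in> {0..a} \<Longrightarrow> (ux t has_real_derivative uxx t x) (at x within {0..a})"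
    and pde: "0 < t \<Longrightarrow> x \<in> {0<..<a} \<Longrightarrow> ut t x = u t x powr p * (uxx t x + u t x - mean a (u t))"
    and bc: "0 < t \<Longrightarrow> ux t 0 = 0" "0 < t \<Longrightarrow> ux t a = 0"
begin

abbreviation m :: "real \<Rightarrow> real" where "m t \<equiv> mean a (u t)"

abbreviation I :: "(real \<Rightarrow> real) \<Rightarrow> real" where "I \<equiv> integral {0..a}"

definition w :: "real \<Rightarrow> real \<Rightarrow> real" where "w t x = uxx t x + u t x - m t"

text \<open>Minus the energy.\<close>

definition D :: "real \<Rightarrow> real" where
  "D t = I (\<lambda>x. (u t x - m t)\<^sup>2) - I (\<lambda>x. (ux t x)\<^sup>2)"

definition Y :: "real \<Rightarrow> real" where "Y t = I (\<lambda>x. u t x powr (2 - p))"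

definition S :: "real \<Rightarrow> real" where "S t = I (\<lambda>x. ut t x * w t x)"

section \<open>Joint continuity and the equation up to the boundary\<close>

lemma continuous_slice:
  assumes "continuous_on (T \<times> {0..a}) (\<lambda>(t, x). h t x)" "t \<in> T"
  shows "continuous_on {0..a} (h t)"
proof -
  have "continuous_on {0..a} (\<lambda>x. case (t, x) of (t, x) \<Rightarrow> h t x)"
    by (intro continuous_on_compose2[OF assms(1)] continuous_intros) (use assms(2) in auto)
  then show ?thesis by simp
qed

lemma continuous_integral:
  assumes "continuous_on (T \<times> {0..a}) (\<lambda>(t, x). h t x)"
  shows "continuous_on T (\<lambda>t. I (h t))"
  using integral_continuous_on_param[of T 0 a h] assms by simp

lemma integrable_I: "continuous_on {0..a} h \<Longrightarrow> h integrable_on {0..a}" for h :: "real \<Rightarrow> real"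
  by (rule integrable_continuous_interval)

lemma cont_u_slice: "0 \<le> t \<Longrightarrow> continuous_on {0..a} (u t)"
  by (rule continuous_slice[OF cont_u]) auto

lemma cont_slices:
  assumes "0 < t"
  shows "continuous_on {0..a} (ut t)" "continuous_on {0..a} (ux t)" "continuous_on {0..a} (uxx t)"
  using assms by (auto intro: continuous_slice[OF cont_ut] continuous_slice[OF cont_ux] continuous_slice[OF cont_uxx])

lemma mean_eq: "0 \<le> t \<Longrightarrow> m t = I (u t) / a"
  unfolding mean_def
  by (subst set_borel_integral_eq_integral) (auto intro!: borel_integrable_atLeastAtMost' cont_u_slice)

lemma cont_m: "continuous_on {0..} m"
proof -
  have "continuous_on {0..} (\<lambda>t. I (u t) / a)"
    using a by (intro continuous_intros continuous_integral cont_u) auto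
  then show ?thesis by (rule continuous_on_eq) (use mean_eq in auto)
qed

lemma cont_m_pair: "T \<subseteq> {0..} \<Longrightarrow> continuous_on (T \<times> X) (\<lambda>(t, x). m t)"
  unfolding split_beta by (intro continuous_on_compose2[OF cont_m] continuous_intros) auto

lemma cont_w: "continuous_on ({0<..} \<times> {0..a}) (\<lambda>(t, x). w t x)"
proof -
  have "continuous_on ({0<..} \<times> {0..a}) (\<lambda>z. (case z of (t, x) \<Rightarrow> uxx t x) + (case z of (t, x) \<Rightarrow> u t x) - (case z of (t, x) \<Rightarrow> m t))"
    by (intro continuous_intros cont_uxx cont_m_pair continuous_on_subset[OF cont_u]) auto
  then show ?thesis by (simp add: w_def split_beta)
qed

lemma cont_w_slice: "0 < t \<Longrightarrow> continuous_on {0..a} (w t)"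
  by (rule continuous_slice[OF cont_w]) auto

lemmas cont_all = cont_u_slice cont_slices cont_w_slice

text \<open>The equation is given at interior points only. Both sides are continuous on [0,a],
  thanks to u > 0, so the identity reaches the end points.\<close>

lemma w_eq:
  assumes "0 < t" "x \<in> {0..a}"
  shows "w t x = u t x powr (- p) * ut t x"
proof -
  have "w t x - u t x powr (- p) * ut t x = 0"
  proof (rule continuous_constant_on_closure[where S = "{0<..<a}" and f = "\<lambda>x. w t x - u t x powr (- p) * ut t x"])
    show "continuous_on (closure {0<..<a}) (\<lambda>x. w t x - u t x powr (- p) * ut t x)"
      using a assms pos[of t] by (auto intro!: continuous_intros cont_all) (metis atLeastAtMost_iff less_irrefl)
    show "x \<in> closure {0<..<a}" using a assms by simp
    fix y assume y: "y \<in> {0<..<a}"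
    then have "0 < u t y" using assms pos[of t y] by simp
    then have "u t y powr (- p) * u t y powr p = 1"
      by (simp add: powr_minus)
    then show "w t y - u t y powr (- p) * ut t y = 0"
      using pde[OF assms(1) y] by (simp add: w_def flip: mult.assoc)
  qed
  then show ?thesis by simp
qed

section \<open>Time derivatives of the energy and of Y\<close>

lemma leibniz:
  assumes h: "\<And>t x. 0 < t \<Longrightarrow> x \<in> {0..a} \<Longrightarrow> ((\<lambda>s. h s x) has_real_derivative h' t x) (at t)"
    and h': "continuous_on ({0<..} \<times> {0..a}) (\<lambda>(t, x). h' t x)"
    and c: "\<And>t. 0 < t \<Longrightarrow> continuous_on {0..a} (h t)" and t: "0 < t"
  shows "((\<lambda>t. I (h t)) has_real_derivative I (h' t)) (at t)"
proof -
  have "((\<lambda>t. integral (cbox 0 a) (h t)) has_real_derivative integral (cbox 0 a) (h' t)) (at t within {0<..})"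
    by (rule leibniz_rule_field_derivative)
      (use h h' c t in \<open>auto intro: has_field_derivative_at_within integrable_I\<close>)
  then show ?thesis using t at_within_open[of t "{0<..}"] by simp
qed

lemma cont_powr: "T \<subseteq> {0..} \<Longrightarrow> continuous_on (T \<times> {0..a}) (\<lambda>(t, x). u t x powr q)"
proof -
  assume "T \<subseteq> {0..}"
  then have "continuous_on (T \<times> {0..a}) (\<lambda>z. (case z of (t, x) \<Rightarrow> u t x) powr q)"
    by (intro continuous_on_powr continuous_on_subset[OF cont_u] continuous_on_const)
      (use pos in \<open>force\<close>)+
  then show ?thesis by (simp add: split_beta)
qed

text \<open>The Neumann condition on \<open>ux s\<close> removes the boundary terms, so
  \<open>v\<close> is free at the ends; it will be the solution at a possibly different
  time.\<close>

lemma by_parts: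
  assumes v: "\<And>x. x \<in> {0..a} \<Longrightarrow> (v has_real_derivative v' x) (at x within {0..a})"
    and v': "continuous_on {0..a} v'" and s: "0 < s"
  shows "I (\<lambda>x. v' x * ux s x) = - I (\<lambda>x. v x * uxx s x)"
proof -
  have cv: "continuous_on {0..a} v" by (rule DERIV_continuous_on[OF v])
  have "((\<lambda>x. v x * ux s x) has_real_derivative v' x * ux s x + v x * uxx s x) (at x within {0..a})"
    if "x \<in> {0..a}" for x
    by (rule DERIV_cong[OF DERIV_mult[OF v deriv_xx]]) (use that s in auto)
  then have "((\<lambda>x. v' x * ux s x + v x * uxx s x) has_integral v a * ux s a - v 0 * ux s 0) {0..a}"
    using a by (intro fundamental_theorem_of_calculus)
      (auto simp flip: has_real_derivative_iff_has_vector_derivative)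
  then have "I (\<lambda>x. v' x * ux s x + v x * uxx s x) = 0"
    using bc[OF s] by (simp add: integral_unique)
  moreover have "I (\<lambda>x. v' x * ux s x + v x * uxx s x) = I (\<lambda>x. v' x * ux s x) + I (\<lambda>x. v x * uxx s x)"
    by (intro integral_add integrable_I continuous_intros cv v' cont_slices s)
  ultimately show ?thesis by simp
qed

lemma integral_centered: "0 \<le> t \<Longrightarrow> I (\<lambda>x. u t x - m t) = 0"
  using a by (subst integral_diff) (auto intro!: integrable_I cont_u_slice simp: mean_eq)

text \<open>The point is that the right-hand side is symmetric in t and s. Subtracting
  \<open>m t\<close> from the first factor is harmless because \<open>u s x - m s\<close> has
  integral 0.\<close>

lemma bilinear_eq:
  assumes t: "0 < t" and s: "0 < s"
  shows "I (\<lambda>x. u t x * w s x) = I (\<lambda>x. (u t x - m t) * (u s x - m s)) - I (\<lambda>x. ux t x * ux s x)"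
proof -
  have ts: "0 \<le> t" "0 \<le> s" using t s by auto
  have "I (\<lambda>x. u t x * w s x) = I (\<lambda>x. u t x * uxx s x + u t x * (u s x - m s))"
    by (intro arg_cong[where f = I]) (auto simp: w_def algebra_simps)
  also have "\<dots> = I (\<lambda>x. u t x * uxx s x) + I (\<lambda>x. u t x * (u s x - m s))"
    by (intro integral_add integrable_I continuous_intros cont_all t s ts)
  also have "I (\<lambda>x. u t x * uxx s x) = - I (\<lambda>x. ux t x * ux s x)"
    using by_parts[of "u t" "ux t" s] deriv_x[OF t] cont_slices[OF t] s by simp
  also have "I (\<lambda>x. (u t x - m t) * (u s x - m s)) = I (\<lambda>x. u t x * (u s x - m s) - m t * (u s x - m s))"
    by (simp add: left_diff_distrib)
  then have "I (\<lambda>x. u t x * (u s x - m s)) = I (\<lambda>x. (u t x - m t) * (u s x - m s)) + m t * I (\<lambda>x. u s x - m s)"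
    by (subst (asm) integral_diff) (auto intro!: integrable_I continuous_intros cont_all t s ts)
  finally show ?thesis using integral_centered[OF ts(2)] by simp
qed

lemma D_eq: "0 < t \<Longrightarrow> D t = I (\<lambda>x. u t x * w t x)"
  by (simp add: bilinear_eq D_def power2_eq_square)

text \<open>A difference of a quadratic form, integrated by parts at the two times separately: differentiating
  the energy then does not require the mixed derivative \<open>u\<^sub>x\<^sub>t\<close>.\<close>

lemma D_diff:
  assumes t: "0 < t" and s: "0 < s"
  shows "D s - D t = 2 * I (\<lambda>x. (u s x - u t x) * w t x) + I (\<lambda>x. (u s x - u t x) * (w s x - w t x))"
proof -
  have ts: "0 \<le> t" "0 \<le> s" using t s by auto
  have 1: "I (\<lambda>x. (u s x - u t x) * w r x) = I (\<lambda>x. u s x * w r x) - I (\<lambda>x. u t x * w r x)" if "0 < r" for r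
    unfolding left_diff_distrib
    by (intro integral_diff integrable_I continuous_intros cont_all t s ts that)
  have 2: "I (\<lambda>x. (u s x - u t x) * (w s x - w t x)) =
      I (\<lambda>x. (u s x - u t x) * w s x) - I (\<lambda>x. (u s x - u t x) * w t x)"
    unfolding right_diff_distrib
    by (intro integral_diff integrable_I continuous_intros cont_all t s ts)
  have "I (\<lambda>x. u s x * w t x) = I (\<lambda>x. u t x * w s x)"
    by (simp add: bilinear_eq t s mult.commute)
  then show ?thesis unfolding 2 1[OF t] 1[OF s] by (simp add: D_eq t s)
qed

text \<open>With the weight frozen at \<open>w t\<close>, the main term is differentiated under the
  integral. In the remainder, u s - u t is O(|s - t|) and w s - w t tends to 0 in the mean, so
  continuity of \<open>w\<close> in time is enough.\<close>

lemma D_deriv: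
  assumes t: "0 < t"
  shows "(D has_real_derivative 2 * S t) (at t)"
proof -
  have c: "continuous_on ({0<..} \<times> {0..a}) (\<lambda>(r, x). w t x)"
    unfolding split_beta by (intro continuous_on_compose2[OF cont_w_slice[OF t]] continuous_intros) auto
  have "continuous_on ({0<..} \<times> {0..a}) (\<lambda>z. (case z of (r, x) \<Rightarrow> ut r x) * (case z of (r, x) \<Rightarrow> w t x))"
    by (intro continuous_intros cont_ut c)
  then have "((\<lambda>s. I (\<lambda>x. (u s x - u t x) * w t x)) has_real_derivative I (\<lambda>x. ut t x * w t x)) (at t)"
    by (intro leibniz t) (auto simp: split_beta intro!: derivative_eq_intros deriv_t continuous_intros cont_all t order.strict_implies_order[OF t])
  then have 1: "((\<lambda>s. I (\<lambda>x. (u s x - u t x) * w t x)) has_real_derivative S t) (at t)"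
    by (simp add: S_def)
  define R where "R s = I (\<lambda>x. (u s x - u t x) * (w s x - w t x))" for s
  define J where "J s = I (\<lambda>x. \<bar>w s x - w t x\<bar>)" for s
  \<comment> \<open>The time window around t stays away from 0, where \<open>ut\<close> is
    uncontrolled, and gives a Lipschitz constant uniform in x.\<close>
  have "compact ({t / 2..2 * t} \<times> {0..a})" by (intro compact_Times compact_Icc)
  then have "bounded ((\<lambda>(t, x). ut t x) ` ({t / 2..2 * t} \<times> {0..a}))"
    by (intro compact_imp_bounded compact_continuous_image continuous_on_subset[OF cont_ut]) (use t in auto)
  then obtain C where C: "\<And>s x. s \<in> {t / 2..2 * t} \<Longrightarrow> x \<in> {0..a} \<Longrightarrow> \<bar>ut s x\<bar> \<le> C"
    unfolding bounded_iff by (auto simp only: ball_simps real_norm_def) (metis case_prod_conv mem_Times_iff fst_conv snd_conv)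
  have "(R has_real_derivative 0) (at t)"
    unfolding has_field_derivative_iff
  proof (rule Lim_null_comparison)
    have "norm ((R s - R t) / (s - t)) \<le> C * J s" if s: "s \<in> {t / 2<..<2 * t}" "s \<noteq> t" for s
    proof -
      have s0: "0 < s" "0 \<le> s" "0 \<le> t" using s t by auto
      have lip: "\<bar>u s x - u t x\<bar> \<le> C * \<bar>s - t\<bar>" if "x \<in> {0..a}" for x
      proof -
        have "((\<lambda>s. u s x) has_real_derivative ut r x) (at r within {t / 2..2 * t})"
          if "r \<in> {t / 2..2 * t}" for r
          by (rule has_field_derivative_at_within[OF deriv_t]) (use that t \<open>x \<in> _\<close> in auto)
        then have "norm (u s x - u t x) \<le> C * norm (s - t)"
          by (rule field_differentiable_bound[of "{t / 2..2 * t}" _ "\<lambda>s. ut s x", rotated])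
            (use s t C that in auto)
        then show ?thesis by simp
      qed
      have "\<bar>R s\<bar> \<le> I (\<lambda>x. C * \<bar>s - t\<bar> * \<bar>w s x - w t x\<bar>)"
        unfolding R_def real_norm_def[symmetric]
      proof (rule Henstock_Kurzweil_Integration.integral_norm_bound_integral)
        show "norm ((u s x - u t x) * (w s x - w t x)) \<le> C * norm (s - t) * norm (w s x - w t x)"
          if "x \<in> {0..a}" for x
          using lip[OF that] by (simp add: abs_mult mult_right_mono)
      qed (intro integrable_I continuous_intros cont_all t s0)+
      then have "\<bar>R s\<bar> \<le> C * J s * \<bar>s - t\<bar>" by (simp add: J_def mult_ac)
      moreover have "R t = 0" by (simp add: R_def)
      ultimately show ?thesis using s by (simp add: abs_divide divide_le_eq)
    qed
    moreover have "\<forall>\<^sub>F s in at t. s \<in> {t / 2<..<2 * t} \<and> s \<noteq> t"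
      using t by (intro eventually_conj eventually_at_in_open' eventually_neq_at_within) auto
    ultimately show "\<forall>\<^sub>F s in at t. norm ((R s - R t) / (s - t)) \<le> C * J s"
      by (auto elim: eventually_mono)
    have "continuous_on {0<..} J"
      unfolding J_def[abs_def]
    proof (rule continuous_integral)
      have "continuous_on ({0<..} \<times> {0..a}) (\<lambda>z. \<bar>(case z of (r, x) \<Rightarrow> w r x) - (case z of (r, x) \<Rightarrow> w t x)\<bar>)"
        by (intro continuous_intros cont_w c)
      then show "continuous_on ({0<..} \<times> {0..a}) (\<lambda>(r, x). \<bar>w r x - w t x\<bar>)" by (simp add: split_beta)
    qed
    then have "(J \<longlongrightarrow> J t) (at t)"
      using t by (simp add: continuous_on_eq_continuous_at isCont_def)
    then have "((\<lambda>s. C * J s) \<longlongrightarrow> C * J t) (at t)" by (intro tendsto_intros)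
    then show "((\<lambda>s. C * J s) \<longlongrightarrow> 0) (at t)" by (simp add: J_def)
  qed
  with 1 have "((\<lambda>s. D t + (2 * I (\<lambda>x. (u s x - u t x) * w t x) + R s)) has_real_derivative 0 + (2 * S t + 0)) (at t)"
    by (intro DERIV_add DERIV_cmult DERIV_const)
  moreover have "\<forall>\<^sub>F s in nhds t. D s = D t + (2 * I (\<lambda>x. (u s x - u t x) * w t x) + R s)"
  proof (rule eventually_mono)
    show "\<forall>\<^sub>F s in nhds t. s \<in> {0<..}"
      using t by (intro eventually_nhds_in_open) auto
    show "D s = D t + (2 * I (\<lambda>x. (u s x - u t x) * w t x) + R s)" if "s \<in> {0<..}" for s
      using D_diff[OF t, of s] that by (simp add: R_def)
  qed
  ultimately show ?thesis by (subst DERIV_cong_ev[OF refl _ refl]) auto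
qed

lemma S_eq: "0 < t \<Longrightarrow> S t = I (\<lambda>x. u t x powr (- p) * (ut t x)\<^sup>2)"
  unfolding S_def by (rule integral_cong) (simp add: w_eq power2_eq_square mult_ac)

lemma S_nonneg: "0 < t \<Longrightarrow> 0 \<le> S t"
  unfolding S_eq by (rule integral_nonneg)
    (auto intro!: integrable_I continuous_intros cont_all simp: less_imp_neq[OF pos, symmetric] less_imp_le)

lemma D_eq_powr:
  assumes t: "0 < t" shows "D t = I (\<lambda>x. u t x powr (1 - p) * ut t x)"
  unfolding D_eq[OF t]
proof (rule integral_cong)
  fix x assume x: "x \<in> {0..a}"
  have "u t x * u t x powr (- p) = u t x powr (1 - p)"
    using pos[of t x] x t powr_add[of "u t x" 1 "- p"] by simp
  then show "u t x * w t x = u t x powr (1 - p) * ut t x"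
    by (simp add: w_eq[OF t x] flip: mult.assoc)
qed

lemma Y_deriv:
  assumes t: "0 < t"
  shows "(Y has_real_derivative (2 - p) * D t) (at t)"
proof -
  have "continuous_on ({0<..} \<times> {0..a}) (\<lambda>z. (2 - p) * ((case z of (t, x) \<Rightarrow> u t x powr (1 - p)) * (case z of (t, x) \<Rightarrow> ut t x)))"
    by (intro continuous_intros cont_powr cont_ut) auto
  then have c: "continuous_on ({0<..} \<times> {0..a}) (\<lambda>(t, x). (2 - p) * (u t x powr (1 - p) * ut t x))"
    by (simp add: split_beta)
  have "(Y has_real_derivative I (\<lambda>x. (2 - p) * (u t x powr (1 - p) * ut t x))) (at t)"
    unfolding Y_def[abs_def]
  proof (rule leibniz[OF _ c _ t])
    fix t x :: real assume tx: "0 < t" "x \<in> {0..a}"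
    show "((\<lambda>s. u s x powr (2 - p)) has_real_derivative (2 - p) * (u t x powr (1 - p) * ut t x)) (at t)"
      using DERIV_fun_powr[OF deriv_t[OF tx], of "2 - p"] pos[of t x] tx by (simp add: mult.assoc)
  next
    show "continuous_on {0..a} (\<lambda>x. u t x powr (2 - p))" if "0 < t" for t
      by (rule continuous_slice[OF cont_powr[of "{0<..}"]]) (use that in auto)
  qed
  then show ?thesis using D_eq_powr[OF t] by simp
qed

lemma Y_pos:
  assumes t: "0 < t" shows "0 < Y t"
proof -
  have c: "continuous_on {0..a} (\<lambda>x. u t x powr (2 - p))"
    by (rule continuous_slice[OF cont_powr[of "{0<..}"]]) (use t in auto)
  have "0 \<le> Y t" unfolding Y_def by (rule integral_nonneg[OF integrable_I[OF c]]) simp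
  moreover have "Y t \<noteq> 0"
    unfolding Y_def using integral_eq_0_iff[OF c] a t pos[of t 0] by force
  ultimately show ?thesis by simp
qed

text \<open>For the inner product with weight u^(-p), \<open>Y\<close> and \<open>S\<close> are the
  squared norms of u and u_t, and \<open>D\<close> is their inner product. The squared norm of Y u_t
  - D u equals Y (Y S - D^2), and Y > 0 cancels.\<close>

lemma cauchy_schwarz:
  assumes t: "0 < t" shows "(D t)\<^sup>2 \<le> Y t * S t"
proof -
  have c: "continuous_on {0..a} (\<lambda>x. u t x powr q)" for q
    by (rule continuous_slice[OF cont_powr[of "{0<..}"]]) (use t in auto)
  have "((\<lambda>x. (Y t)\<^sup>2 * (u t x powr (- p) * (ut t x)\<^sup>2) - 2 * Y t * D t * (u t x powr (1 - p) * ut t x)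
      + (D t)\<^sup>2 * u t x powr (2 - p)) has_integral (Y t)\<^sup>2 * S t - 2 * Y t * D t * D t + (D t)\<^sup>2 * Y t) {0..a}"
    unfolding S_eq[OF t] D_eq_powr[OF t] Y_def
    by (intro has_integral_add has_integral_diff has_integral_mult_right integrable_integral
      integrable_I continuous_intros c cont_slices t)
  then have "0 \<le> (Y t)\<^sup>2 * S t - 2 * Y t * D t * D t + (D t)\<^sup>2 * Y t"
  proof (rule has_integral_nonneg)
    fix x assume x: "x \<in> {0..a}"
    have "u t x powr (1 - p) = u t x powr (- p) * u t x" "u t x powr (2 - p) = u t x powr (- p) * (u t x)\<^sup>2"
      using pos[of t x] x t powr_add[of "u t x" 1 "- p"] powr_add[of "u t x" 2 "- p"] by auto
    then have "(Y t)\<^sup>2 * (u t x powr (- p) * (ut t x)\<^sup>2) - 2 * Y t * D t * (u t x powr (1 - p) * ut t x)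
      + (D t)\<^sup>2 * u t x powr (2 - p) = u t x powr (- p) * (Y t * ut t x - D t * u t x)\<^sup>2"
      by (simp add: power2_eq_square algebra_simps)
    then show "0 \<le> (Y t)\<^sup>2 * (u t x powr (- p) * (ut t x)\<^sup>2) - 2 * Y t * D t * (u t x powr (1 - p) * ut t x)
      + (D t)\<^sup>2 * u t x powr (2 - p)" by simp
  qed
  also have "\<dots> = Y t * (Y t * S t - (D t)\<^sup>2)" by (simp add: power2_eq_square algebra_simps)
  finally show ?thesis using Y_pos[OF t] by (simp add: zero_le_mult_iff)
qed

section \<open>Passing negative energy from the initial time to positive times\<close>

lemma D_mono:
  assumes "0 < s" "s \<le> t" shows "D s \<le> D t"
  by (rule DERIV_nonneg_imp_nondecreasing[OF assms(2)])
    (use assms in \<open>force intro!: exI[of _ "2 * S _"] D_deriv S_nonneg\<close>)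

text \<open>By the equation, the integral is the time derivative of \<open>I (\<lambda>x. G (u 0 x) (u t x))\<close> for the
  function \<open>G v\<close> below, which has its minimum at \<open>v\<close>.\<close>

lemma exists_dissipation_nonneg:
  assumes \<tau>: "0 < \<tau>"
  obtains \<xi> where "0 < \<xi>" "\<xi> < \<tau>" "0 \<le> I (\<lambda>x. (u \<xi> x - u 0 x) * w \<xi> x)"
proof -
  obtain N M where N: "\<And>s. 0 < s \<Longrightarrow> (N has_real_derivative s powr (1 - p)) (at s)"
    and M: "\<And>s. 0 < s \<Longrightarrow> (M has_real_derivative s powr (- p)) (at s)"
    using powr_primitives[OF p] by blast
  \<comment> \<open>Its derivative in s is s^(-p) (s - v), with the sign of s - v. Along the
    solution the factor u^(-p) turns u_t into \<open>w\<close>.\<close>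
  define G where "G v s = N s - v * M s" for v s
  have G: "(G v has_real_derivative s powr (- p) * (s - v)) (at s)" if "0 < s" for s v
  proof -
    have "s powr (1 - p) = s powr (- p) * s"
      using that powr_add[of s 1 "- p"] by simp
    then show ?thesis
      unfolding G_def[abs_def] using DERIV_diff[OF N DERIV_cmult[OF M], of s v] that
      by (simp add: algebra_simps)
  qed
  have G_min: "G v v \<le> G v s" if v: "0 < v" and s: "0 < s" for v s
  proof (cases "v \<le> s")
    case True
    then show ?thesis
    proof (rule DERIV_nonneg_imp_nondecreasing)
      fix x assume "v \<le> x" "x \<le> s"
      then show "\<exists>y. (G v has_real_derivative y) (at x) \<and> 0 \<le> y"
        using v by (intro exI[of _ "x powr (- p) * (x - v)"] conjI G) auto
    qed
  next
    case False
    then have "s \<le> v" by simp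
    then show ?thesis
    proof (rule DERIV_nonpos_imp_nonincreasing)
      fix x assume "s \<le> x" "x \<le> v"
      then show "\<exists>y. (G v has_real_derivative y) (at x) \<and> y \<le> 0"
        using s by (intro exI[of _ "x powr (- p) * (x - v)"] conjI G) (auto simp: mult_nonneg_nonpos)
    qed
  qed
  define \<Phi> where "\<Phi> t = I (\<lambda>x. G (u 0 x) (u t x))" for t
  have cN: "continuous_on {0<..} N" and cM: "continuous_on {0<..} M"
    using N M by (auto intro!: continuous_at_imp_continuous_on DERIV_isCont)
  have cu0: "continuous_on (T \<times> {0..a}) (\<lambda>z. u 0 (snd z))" for T :: "real set"
    by (intro continuous_on_compose2[OF cont_u_slice[of 0]] continuous_intros) auto
  have cu: "continuous_on ({0..} \<times> {0..a}) (\<lambda>z. u (fst z) (snd z))"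
    using cont_u by (simp add: split_beta)
  have cG: "continuous_on ({0..} \<times> {0..a}) (\<lambda>(t, x). G (u 0 x) (u t x))"
    unfolding G_def split_beta
    by (intro continuous_intros cu0 continuous_on_compose2[OF cN cu] continuous_on_compose2[OF cM cu])
      (use pos in auto)
  have c\<Phi>: "continuous_on {0..} \<Phi>"
    unfolding \<Phi>_def[abs_def] by (rule continuous_integral[OF cG])
  have d\<Phi>: "(\<Phi> has_real_derivative I (\<lambda>x. (u t x - u 0 x) * w t x)) (at t)" if t: "0 < t" for t
    unfolding \<Phi>_def[abs_def]
  proof (rule leibniz[OF _ _ _ t])
    fix t x :: real assume tx: "0 < t" "x \<in> {0..a}"
    have "((\<lambda>s. G (u 0 x) (u s x)) has_real_derivative u t x powr (- p) * (u t x - u 0 x) * ut t x) (at t)"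
      by (rule DERIV_chain2[OF G deriv_t[OF tx]]) (use pos[of t x] tx in auto)
    then show "((\<lambda>s. G (u 0 x) (u s x)) has_real_derivative (u t x - u 0 x) * w t x) (at t)"
      by (simp add: w_eq[OF tx] mult_ac)
  next
    have "continuous_on ({0<..} \<times> {0..a}) (\<lambda>z. (u (fst z) (snd z) - u 0 (snd z)) * (case z of (t, x) \<Rightarrow> w t x))"
      by (intro continuous_intros cont_w cu0 continuous_on_subset[OF cu]) auto
    then show "continuous_on ({0<..} \<times> {0..a}) (\<lambda>(t, x). (u t x - u 0 x) * w t x)"
      by (simp add: split_beta)
    show "continuous_on {0..a} (\<lambda>x. G (u 0 x) (u t x))" if "0 < t" for t
      by (rule continuous_slice[OF cG]) (use that in auto)
  qed
  have "continuous_on {0..\<tau>} \<Phi>"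
    by (rule continuous_on_subset[OF c\<Phi>]) auto
  \<comment> \<open>The mean value theorem asks only for continuity of \<Phi> at 0, so the possible
    blow-up of \<open>w\<close> as t tends to 0 does no harm. The price is that the sign is known
    only at some small times.\<close>
  then obtain \<xi> where \<xi>: "0 < \<xi>" "\<xi> < \<tau>"
    "\<Phi> \<tau> - \<Phi> 0 = I (\<lambda>x. (u \<xi> x - u 0 x) * w \<xi> x) * (\<tau> - 0)"
    by (rule mvt[OF \<tau>, where f' = "\<lambda>\<xi>. (*) (I (\<lambda>x. (u \<xi> x - u 0 x) * w \<xi> x))"])
      (use d\<Phi> in \<open>simp add: has_field_derivative_def\<close>)
  have "\<Phi> 0 \<le> \<Phi> \<tau>"
    unfolding \<Phi>_def
  proof (rule Henstock_Kurzweil_Integration.integral_le)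
    show "G (u 0 x) (u 0 x) \<le> G (u 0 x) (u \<tau> x)" if "x \<in> {0..a}" for x
      by (rule G_min) (use pos that \<tau> in auto)
  qed (use \<tau> in \<open>auto intro!: integrable_I continuous_slice[OF cG]\<close>)
  then have "0 \<le> I (\<lambda>x. (u \<xi> x - u 0 x) * w \<xi> x) * \<tau>"
    using \<xi>(3) by simp
  then have "0 \<le> I (\<lambda>x. (u \<xi> x - u 0 x) * w \<xi> x)"
    using \<tau> by (simp add: zero_le_mult_iff)
  then show ?thesis using that \<xi> by blast
qed

text \<open>A lower bound for \<open>E[u(0)] - E[u(t)]\<close> at the times provided by \<open>exists_dissipation_nonneg\<close>.\<close>

definition initial_defect :: "real \<Rightarrow> real" where
  "initial_defect t = I (\<lambda>x. (u t x - m t)\<^sup>2) - 2 * I (\<lambda>x. (u t x - u 0 x) * (u t x - m t))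
    - I (\<lambda>x. (u 0 x - m 0)\<^sup>2)"

text \<open>No spatial derivative occurs in this expression, so continuity of \<open>u\<close> down
  to t = 0 suffices.\<close>

lemma initial_defect_tendsto: "(initial_defect \<longlongrightarrow> 0) (at_right 0)"
proof -
  have cu: "continuous_on ({0..} \<times> {0..a}) (\<lambda>z. u (fst z) (snd z))"
    using cont_u by (simp add: split_beta)
  have cm: "continuous_on ({0..} \<times> {0..a}) (\<lambda>z. m (fst z))"
    using cont_m_pair[of "{0..}"] by (simp add: split_beta)
  have cu0: "continuous_on ({0..} \<times> {0..a}) (\<lambda>z. u 0 (snd z))"
    by (intro continuous_on_compose2[OF cont_u_slice[of 0]] continuous_intros) auto
  have "continuous_on {0..} initial_defect"
    unfolding initial_defect_def[abs_def]
    by (intro continuous_intros continuous_integral; unfold split_beta;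
        intro continuous_intros cu cm cu0)
  moreover have "initial_defect 0 = 0" by (simp add: initial_defect_def)
  ultimately have "(initial_defect \<longlongrightarrow> 0) (at 0 within {0..})"
    unfolding continuous_on_def by (metis atLeast_iff order_refl)
  then show ?thesis by (rule tendsto_within_subset) auto
qed

text \<open>The favourable times s need only be arbitrarily small: monotonicity of \<open>D\<close>
  carries the bound from s to t, and the slack e absorbs \<open>initial_defect s\<close>.\<close>

lemma D_ge:
  assumes t: "0 < t" and g: "square_integrable a g" and wd: "is_weak_deriv a (u 0) g"
  shows "I (\<lambda>x. (u 0 x - m 0)\<^sup>2) - I (\<lambda>x. (g x)\<^sup>2) \<le> D t"
proof (rule field_le_epsilon)
  fix e :: real assume "0 < e"
  then have "\<forall>\<^sub>F s in at_right 0. - e < initial_defect s"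
    using order_tendstoD(1)[OF initial_defect_tendsto, of "- e"] by simp
  then obtain b where b: "0 < b" "\<And>s. 0 < s \<Longrightarrow> s < b \<Longrightarrow> - e < initial_defect s"
    by (auto simp: eventually_at_right_field)
  obtain s where s: "0 < s" "s < min b t" and nonneg: "0 \<le> I (\<lambda>x. (u s x - u 0 x) * w s x)"
    using exists_dissipation_nonneg[of "min b t"] b t by auto
  have s0: "0 \<le> s" "(0::real) \<le> 0" using s by auto
  \<comment> \<open>Here \<phi> is \<open>ux s\<close>, which vanishes at both ends by the Neumann
    condition.\<close>
  have *: "- 2 * I (\<lambda>x. u 0 x * uxx s x) - I (\<lambda>x. (ux s x)\<^sup>2) \<le> I (\<lambda>x. (g x)\<^sup>2)"
    by (rule weak_deriv_dirichlet_ge[OF a cont_u_slice g wd deriv_xx cont_slices(3)]) (use s bc in auto)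
  have "I (\<lambda>x. (u s x - u 0 x) * w s x) =
      I (\<lambda>x. u s x * uxx s x - u 0 x * uxx s x + (u s x - u 0 x) * (u s x - m s))"
    by (intro arg_cong[where f = I]) (auto simp: w_def algebra_simps)
  also have "\<dots> = I (\<lambda>x. u s x * uxx s x) - I (\<lambda>x. u 0 x * uxx s x) + I (\<lambda>x. (u s x - u 0 x) * (u s x - m s))"
    by (intro integral_unique has_integral_add has_integral_diff integrable_integral integrable_I
        continuous_intros cont_all s s0)
  also have "I (\<lambda>x. u s x * uxx s x) = - I (\<lambda>x. (ux s x)\<^sup>2)"
    using by_parts[of "u s" "ux s" s] deriv_x cont_slices s by (simp add: power2_eq_square)
  \<comment> \<open>Twice the dissipation contains -2 I(ux^2) - 2 I(u0 uxx), with u0 for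
    \<open>u 0\<close>. The bound \<open>*\<close> replaces the second term by I(g^2) + I(ux^2), and
    the remaining -I(ux^2) is the one in \<open>D s\<close>.\<close>
  finally have "initial_defect s - D s \<le> I (\<lambda>x. (g x)\<^sup>2) - I (\<lambda>x. (u 0 x - m 0)\<^sup>2)"
    using * nonneg by (simp add: initial_defect_def D_def)
  moreover have "D s \<le> D t" using D_mono[of s t] s by simp
  moreover have "- e < initial_defect s" using b s by simp
  ultimately show "I (\<lambda>x. (u 0 x - m 0)\<^sup>2) - I (\<lambda>x. (g x)\<^sup>2) \<le> D t + e" by linarith
qed

section \<open>The contradiction for global solutions\<close>

lemma exists_D_nonpos: "\<exists>t>0. D t \<le> 0"
proof (rule ccontr)
  assume "\<not> ?thesis"
  then have D: "0 < D t" if "0 < t" for t using that by (meson not_le)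
  \<comment> \<open>Adding p t turns the differential inequality for Y / D into
    monotonicity.\<close>
  define Z where "Z t = Y t / D t + p * t" for t
  \<comment> \<open>The comparison starts at time 1 because derivatives exist only for positive
    times. At this t one has p t = \<open>Z 1\<close>, so \<open>Z t \<le> Z 1\<close> leaves Y / D
    \<le> 0.\<close>
  define t where "t = 1 + (Y 1 / D 1) / p"
  have t: "1 \<le> t" using D[of 1] Y_pos[of 1] p by (simp add: t_def)
  have "Z t \<le> Z 1"
    using t
  proof (rule DERIV_nonpos_imp_nonincreasing)
    fix s assume "1 \<le> s" "s \<le> t"
    then have s: "0 < s" by simp
    have "(Z has_real_derivative ((2 - p) * D s * D s - Y s * (2 * S s)) / (D s * D s) + p) (at s)"
      unfolding Z_def[abs_def] using D[OF s]
      by (intro DERIV_add DERIV_divide Y_deriv D_deriv s) (auto intro!: derivative_eq_intros)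
    moreover have "((2 - p) * D s * D s - Y s * (2 * S s)) / (D s * D s) + p \<le> 0"
    proof -
      have "(2 - p) * D s * D s - Y s * (2 * S s) \<le> - p * (D s * D s)"
        using cauchy_schwarz[OF s] by (simp add: power2_eq_square algebra_simps)
      then show ?thesis using D[OF s] by (simp add: field_simps)
    qed
    ultimately show "\<exists>y. (Z has_real_derivative y) (at s) \<and> y \<le> 0" by blast
  qed
  moreover have "p * t = p + Y 1 / D 1"
    using p by (simp add: t_def field_simps)
  ultimately have "Y t / D t \<le> 0" by (simp add: Z_def)
  moreover have "0 < Y t / D t" using D[of t] Y_pos[of t] t by simp
  ultimately show False by simp
qed

lemma energy_nonneg: "0 \<le> energy a (u 0)"
proof (rule ccontr)
  assume "\<not> ?thesis"
  then have neg: "energy a (u 0) < 0" by simp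
  then have "energy a (u 0) < \<infinity>" by (rule order_less_trans) simp
  then obtain g where g: "square_integrable a g" "is_weak_deriv a (u 0) g"
    "energy a (u 0) = ereal (I (\<lambda>x. (g x)\<^sup>2) - I (\<lambda>x. (u 0 x - m 0)\<^sup>2))"
    by (rule energy_less_top) (rule cont_u_slice, simp)
  obtain t where t: "0 < t" "D t \<le> 0" using exists_D_nonpos by blast
  show False using D_ge[OF t(1) g(1,2)] t(2) neg g(3) by simp
qed

end

theorem theorem1p1:
  fixes p a :: real and u0 :: "real \<Rightarrow> real"
    and u :: "real \<Rightarrow> real \<Rightarrow> real" and Tmax :: ereal
  assumes "p > 1" and "a > 0"
    and "continuous_on {0..a} u0"
    and "\<forall>x\<in>{0..a}. u0 x > 0"
    and "maximal_solution p a u0 Tmax u"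
    and "energy a (u 0) < 0"
  shows "Tmax < \<infinity>"
proof (rule ccontr)
  assume "\<not> Tmax < \<infinity>"
  then have sol: "classical_solution p a u0 \<infinity> u"
    using assms(5) by (simp add: maximal_solution_def)
  have less_top: "ereal t < \<infinity> \<longleftrightarrow> True" for t by simp
  have sets: "{t. 0 \<le> t} = {0 :: real..}" "{t. 0 < t} = {0 :: real<..}" by auto
  obtain ut ux uxx where
    "continuous_on ({0..} \<times> {0..a}) (\<lambda>(t, x). u t x)"
    "\<forall>t x. 0 \<le> t \<and> x \<in> {0..a} \<longrightarrow> 0 < u t x"
    "continuous_on ({0<..} \<times> {0..a}) (\<lambda>(t, x). ut t x)"
    "continuous_on ({0<..} \<times> {0..a}) (\<lambda>(t, x). ux t x)"
    "continuous_on ({0<..} \<times> {0..a}) (\<lambda>(t, x). uxx t x)"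
    "\<forall>t x. 0 < t \<and> x \<in> {0..a} \<longrightarrow>
      ((\<lambda>s. u s x) has_real_derivative ut t x) (at t) \<and>
      (u t has_real_derivative ux t x) (at x within {0..a}) \<and>
      (ux t has_real_derivative uxx t x) (at x within {0..a})"
    "\<forall>t x. 0 < t \<and> x \<in> {0<..<a} \<longrightarrow>
      ut t x = u t x powr p * (uxx t x + u t x - mean a (u t))"
    "\<forall>t. 0 < t \<longrightarrow> ux t 0 = 0 \<and> ux t a = 0"
    using sol unfolding classical_solution_def less_top simp_thms sets
    by (elim conjE exE) (rule that; assumption)
  then have "global_solution p a u ut ux uxx"
    using assms(1,2) by (intro global_solution.intro) blast+
  then show False
    using global_solution.energy_nonneg assms(6) by (meson not_le)
qed

end
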